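(* Let $0<\gamma<1$. Assume that $f(\cdot,\cdot)\in L^\infty_{\mathrm{loc}}([0,\infty)\times\mathbb{R})$. Moreover, assume that for every compact set $K$ there is $L_K>0$ such that $|f(t,u)-f(t,v)|\le L_K|u-v|$ for a.e. $(t,u),(t,v)\in K$. Consider the equation $D_c^\gamma u=f(t,u)$, $u(0)=u_0$. Then, for a given initial value $u_0$, the solution in $L^\infty_{\mathrm{loc}}[0,T_b)$ is unique. Further: - Any two solutions $u_i\in L^\infty_{\mathrm{loc}}[0,T_b^i)$ $(i=1,2)$ with initial values $u_{1,0}<u_{2,0}$ satisfy $u_1(t)<u_2(t)$ on $[0,\min(T_b^1,T_b^2))$. - For any $T>0$, $M>0$, there exists $C(M,T)>0$ such that any two solutions with $\|u_i\|_{L^\infty[0,T]}\le M$ $(i=1,2)$ and initial values $u_{1,0},u_{2,0}$ satisfy $$\|u_1-u_2\|_{L^\infty[0,T]}\le C(M,T)\,|u_{1,0}-u_{2,0}|.$$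
   Context: Generalized Caputo derivative. For $0<\gamma<1$, $u\in L^1_{\mathrm{loc}}[0,T)$ (integrable on $[0,T']$ for every $T'<T$) and $u_0\in\mathbb{R}$, the $\gamma$-th order generalized Caputo derivative of $u$ associated with initial value $u_0$ is the distribution in $\mathscr{D}'(-\infty,T)$, supported in $[0,T)$, $$D_c^\gamma u=g_{-\gamma}*\big((u-u_0)\theta\big),\qquad g_{-\gamma}=\frac{1}{\Gamma(1-\gamma)}D\big(\theta(t)t^{-\gamma}\big),$$ where $\theta$ is the Heaviside function and $D$ the distributional derivative on $\mathbb{R}$. Strong solution. A function $u\in L^1_{\mathrm{loc}}[0,T)$ is a strong solution of $D_c^\gamma u=f(t,u)$ on $[0,T)$ with initial value $u_0$ if $\lim_{t\to0^+}\frac1t\int_0^t|u(s)-u_0|\,ds=0$, both $D_c^\gamma u$ and $f(t,u(t))$ are locally integrable on $[0,T)$, and the equation holds in the distributional sense in $\mathscr{D}'(-\infty,T)$ (with $f(t,u(t))$ extended by zero to $t<0$). For $f$ locally bounded, this is equivalent to $\lim_{t\to0^+}\frac1t\int_0^t|u(s)-u_0|\,ds=0$ together with $$u(t)=u_0+\frac1{\Gamma(\gamma)}\int_0^t(t-s)^{\gamma-1}f(s,u(s))\,ds,\qquad t\in(0,T).$$ "Solution" means strong solution on the indicated interval. A locally bounded solution is identified with its continuous representative given by this integral equation, with $u(0)=u_0$. $T_b$, $T_b^1$, $T_b^2$ denote the right endpoints of the intervals on which the respective solutions are defined. In the last item the solutions are defined on $[0,T]$, and $C(M,T)$ may depend on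 $f$ and $\gamma$ but not on the particular solutions. The function $f$ is measurable and locally essentially bounded.
   Formalization: The Lipschitz condition is required for a.e. t and all u,v with (t,u),(t,v) in K (f is the representative continuous in u), since with exceptional null sets in the (t,u)-plane f(t,u(t)) is not well defined and uniqueness can fail. *)

theory Defs
  imports "HOL-Analysis.Analysis" "HOL-Probability.Essential_Supremum"
begin

section \<open>Function spaces\<close>

text \<open>
  Functions on a subset of the line are total functions whose values outside that subset are
  irrelevant. The right endpoint \<open>T\<close> of a half-open interval \<open>[0,T)\<close> is an extended real, so that
  \<open>T = \<infinity>\<close> is allowed.
\<close>

definition Ico :: "ereal \<Rightarrow> real set" where
  "Ico T = {t. 0 \<le> t \<and> ereal t < T}"

definition L1_loc :: "ereal \<Rightarrow> (real \<Rightarrow> real) \<Rightarrow> bool" where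
  "L1_loc T u \<longleftrightarrow> (\<forall>T'. ereal T' < T \<longrightarrow> set_integrable lebesgue {0..T'} u)"

definition Linf_norm :: "'a::euclidean_space set \<Rightarrow> ('a \<Rightarrow> real) \<Rightarrow> ereal" where
  "Linf_norm S u = esssup (lebesgue_on S) (\<lambda>x. ereal \<bar>u x\<bar>)"

definition Linf_loc :: "'a::euclidean_space set \<Rightarrow> ('a \<Rightarrow> real) \<Rightarrow> bool" where
  "Linf_loc S u \<longleftrightarrow> u \<in> borel_measurable (lebesgue_on S) \<and>
     (\<forall>K. compact K \<and> K \<subseteq> S \<longrightarrow> Linf_norm K u < \<infinity>)"

section \<open>Distributions on \<open>(-\<infinity>,T)\<close>\<close>

text \<open>
  A distribution is represented by its action on test functions; only its values on
  test functions of \<open>\<D>(-\<infinity>,T)\<close> matter.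
\<close>

type_synonym distribution = "(real \<Rightarrow> real) \<Rightarrow> real"

definition test_fun :: "ereal \<Rightarrow> (real \<Rightarrow> real) \<Rightarrow> bool" where
  "test_fun T \<phi> \<longleftrightarrow>
     (\<forall>n x. (deriv ^^ n) \<phi> field_differentiable (at x)) \<and>
     compact (closure {x. \<phi> x \<noteq> 0}) \<and> closure {x. \<phi> x \<noteq> 0} \<subseteq> {x. ereal x < T}"

definition distr_eq :: "ereal \<Rightarrow> distribution \<Rightarrow> distribution \<Rightarrow> bool" where
  "distr_eq T R S \<longleftrightarrow> (\<forall>\<phi>. test_fun T \<phi> \<longrightarrow> R \<phi> = S \<phi>)"

definition distr_of :: "(real \<Rightarrow> real) \<Rightarrow> distribution" where
  "distr_of w \<phi> = (LINT t|lebesgue. w t * \<phi> t)"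

definition distr_deriv :: "distribution \<Rightarrow> distribution" where
  "distr_deriv R \<phi> = - R (deriv \<phi>)"

text \<open>
  \<open>\<langle>R * S, \<phi>\<rangle> = \<langle>S\<^sub>y, \<langle>R\<^sub>x, \<phi>(x + y)\<rangle>\<rangle>\<close>. This is used only for \<open>R\<close>, \<open>S\<close> supported in \<open>[0,\<infinity>)\<close> and
  \<open>S\<close> given by a function. The inner pairing is then a smooth function of \<open>y\<close> that vanishes to
  the right of the support of \<open>\<phi>\<close>; it need not vanish far to the left, but there \<open>S\<close> is zero.
\<close>

definition distr_conv :: "distribution \<Rightarrow> distribution \<Rightarrow> distribution" where
  "distr_conv R S \<phi> = S (\<lambda>y. R (\<lambda>x. \<phi> (x + y)))"

definition heaviside :: "real \<Rightarrow> real" where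
  "heaviside = indicator {0..}"

section \<open>The generalized Caputo derivative and strong solutions\<close>

definition g_neg :: "real \<Rightarrow> distribution" where
  "g_neg \<gamma> \<phi> =
     1 / Gamma (1 - \<gamma>) * distr_deriv (distr_of (\<lambda>t. heaviside t * t powr (- \<gamma>))) \<phi>"

definition caputo :: "real \<Rightarrow> real \<Rightarrow> (real \<Rightarrow> real) \<Rightarrow> distribution" where
  "caputo \<gamma> u0 u = distr_conv (g_neg \<gamma>) (distr_of (\<lambda>t. (u t - u0) * heaviside t))"

definition strong_solution ::
    "real \<Rightarrow> (real \<times> real \<Rightarrow> real) \<Rightarrow> ereal \<Rightarrow> real \<Rightarrow> (real \<Rightarrow> real) \<Rightarrow> bool" where
  "strong_solution \<gamma> f T u0 u \<longleftrightarrow>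
     0 < T \<and> L1_loc T u \<and>
     ((\<lambda>t. 1 / t * (LINT s:{0..t}|lebesgue. \<bar>u s - u0\<bar>)) \<longlongrightarrow> 0) (at_right 0) \<and>
     (\<exists>h. L1_loc T h \<and> distr_eq T (caputo \<gamma> u0 u) (distr_of (\<lambda>t. heaviside t * h t))) \<and>
     L1_loc T (\<lambda>t. f (t, u t)) \<and>
     distr_eq T (caputo \<gamma> u0 u) (distr_of (\<lambda>t. heaviside t * f (t, u t)))"

text \<open>
  The continuous representative, given by the Volterra integral equation, with which a locally
  bounded strong solution \<open>u\<close> is identified (its value at \<open>0\<close> is \<open>u0\<close>).
\<close>

definition cont_rep ::
    "real \<Rightarrow> (real \<times> real \<Rightarrow> real) \<Rightarrow> real \<Rightarrow> (real \<Rightarrow> real) \<Rightarrow> real \<Rightarrow> real" where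
  "cont_rep \<gamma> f u0 u t =
     u0 + 1 / Gamma \<gamma> * (LINT s:{0..t}|lebesgue. (t - s) powr (\<gamma> - 1) * f (s, u s))"

text \<open>
  Since \<open>f (t, u t)\<close> evaluates \<open>f\<close> on a graph, which is a null set of the plane, the almost
  everywhere Lipschitz condition is to be read as: for almost every time \<open>t\<close>, the function
  \<open>f (t, _)\<close> is Lipschitz on the section of \<open>K\<close> at \<open>t\<close>. Equivalently, \<open>f\<close> denotes the
  representative of its class that is continuous in the second variable. (If one could modify \<open>f\<close> on null sets
  of the plane, uniqueness would fail: let \<open>f\<close> be \<open>1\<close> on the graph of
  \<open>t powr \<gamma> / Gamma (1 + \<gamma>)\<close> and \<open>0\<close> elsewhere.)
\<close>

definition loc_Lipschitz_ae :: "(real \<times> real \<Rightarrow> real) \<Rightarrow> bool" where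
  "loc_Lipschitz_ae f \<longleftrightarrow>
     (\<forall>K. compact K \<and> K \<subseteq> {0..} \<times> UNIV \<longrightarrow>
        (\<exists>L>0. AE t in lebesgue. \<forall>u v. (t, u) \<in> K \<and> (t, v) \<in> K \<longrightarrow>
                 \<bar>f (t, u) - f (t, v)\<bar> \<le> L * \<bar>u - v\<bar>))"

end

theory Submission
  imports Defs
begin

text \<open>
  Write \<open>I\<^sup>\<beta>\<close> for the Riemann--Liouville integral of order \<open>\<beta>\<close>. Testing the equation against smooth
  step functions and letting the steps sharpen gives \<open>I\<^bsup>1-\<gamma>\<^esup> (u - u0) = I\<^sup>1 (f (\<cdot>, u))\<close> pointwise; applying
  \<open>I\<^sup>\<gamma>\<close> and the semigroup law turns this into the Volterra equation \<open>u = u0 + I\<^sup>\<gamma> (f (\<cdot>, u))\<close>. Stability,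
  and with it uniqueness, is a Gronwall argument in an exponentially weighted sup norm.

  For the strict ordering, the difference \<open>W\<close> of the continuous representatives satisfies
  \<open>W = w0 + I\<^sup>\<gamma> H\<close> with \<open>w0 > 0\<close> and \<open>\<bar>H\<bar> \<le> L \<bar>W\<bar>\<close>. Suppose that \<open>W\<close> has a first zero \<open>t\<close>, let \<open>k\<close> be the kernel
  of \<open>I\<^bsup>1-\<gamma>\<^esup>\<close> and \<open>P x = k x * W (t - x)\<close>, which is nonnegative, and bounded because \<open>W\<close> is
  \<open>\<gamma>\<close>-Hoelder. Comparing \<open>I\<^bsup>1-\<gamma>\<^esup> (W - w0) = I\<^sup>1 H\<close> at \<open>t\<close> and at \<open>t - \<epsilon>\<close> shows that, with some \<open>c > 0\<close>, the integral of
  \<open>P\<close> over \<open>{0<..\<epsilon>}\<close> is at least \<open>c \<epsilon>\<close> plus \<open>\<gamma> \<epsilon>\<close> times the integral of \<open>P x / x\<close> over \<open>{\<epsilon><..e}\<close>. By the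
  first term \<open>P\<close> has mean at least \<open>c\<close> near \<open>0\<close>, so the last integral diverges logarithmically as
  \<open>\<epsilon> \<rightarrow> 0\<close>; but the left side is only \<open>O(\<epsilon>)\<close>.
\<close>

section \<open>Riemann--Liouville integrals\<close>

text \<open>The cutoff at \<open>x \<le> 0\<close> lets every convolution run over the whole line.
  For \<open>\<beta> = 1\<close> the kernel is a Heaviside function, so on causal functions
  \<open>rl_int 1\<close> is the ordinary primitive.\<close>

definition rl_kernel :: "real \<Rightarrow> real \<Rightarrow> real" where
  "rl_kernel \<beta> x = (if x > 0 then x powr (\<beta> - 1) / Gamma \<beta> else 0)"

definition rl_int :: "real \<Rightarrow> (real \<Rightarrow> real) \<Rightarrow> real \<Rightarrow> real" where
  "rl_int \<beta> p t = (\<integral>x. rl_kernel \<beta> x * p (t - x) \<partial>lborel)"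

text \<open>The class on which \<open>rl_int\<close> converges absolutely and which it maps to
  itself. Bounds hold everywhere rather than almost everywhere, and Borel measurability keeps the
  Fubini arguments within products of \<open>lborel\<close>.\<close>

definition causal :: "(real \<Rightarrow> real) \<Rightarrow> bool" where
  "causal p \<longleftrightarrow> p \<in> borel_measurable borel \<and> (\<forall>t<0. p t = 0) \<and> (\<forall>R. \<exists>B. \<forall>t\<le>R. \<bar>p t\<bar> \<le> B)"

lemma rl_kernel_measurable [measurable]: "rl_kernel \<beta> \<in> borel_measurable borel"
  unfolding rl_kernel_def[abs_def] by measurable

lemma rl_kernel_nonneg: "\<beta> > 0 \<Longrightarrow> rl_kernel \<beta> x \<ge> 0"
  using Gamma_real_pos[of \<beta>] by (auto simp: rl_kernel_def)

lemma has_bochner_integral_Beta: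
  assumes "a > 0" "b > (0::real)"
  shows "has_bochner_integral lborel (\<lambda>t. indicator {0..1} t * (t powr (a - 1) * (1 - t) powr (b - 1))) (Beta a b)"
  using integrable_Beta[OF assms] set_borel_integral_eq_integral(2)[OF integrable_Beta[OF assms]]
    integral_unique[OF has_integral_Beta_real[OF assms]]
  by (simp add: has_bochner_integral_iff set_integrable_def set_lebesgue_integral_def)

text \<open>Scaling \<open>y = x * s\<close> turns the convolution into the Beta integral, and
  \<open>Beta \<alpha> \<beta>\<close> supplies exactly the missing quotient of Gamma
  values.\<close>

lemma rl_kernel_conv:
  assumes "\<alpha> > 0" "\<beta> > 0"
  shows "has_bochner_integral lborel (\<lambda>y. rl_kernel \<alpha> y * rl_kernel \<beta> (x - y)) (rl_kernel (\<alpha> + \<beta>) x)"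
proof (cases "x > 0")
  case False
  have "(\<lambda>y. rl_kernel \<alpha> y * rl_kernel \<beta> (x - y)) = (\<lambda>y. 0)"
    using False by (auto simp: rl_kernel_def)
  moreover have "rl_kernel (\<alpha> + \<beta>) x = 0"
    using False by (simp add: rl_kernel_def)
  ultimately show ?thesis by (simp only: has_bochner_integral_zero)
next
  case True
  let ?F = "\<lambda>y. rl_kernel \<alpha> y * rl_kernel \<beta> (x - y)"
  let ?G = "\<lambda>s. indicator {0..1} s * (s powr (\<alpha> - 1) * (1 - s) powr (\<beta> - 1))"
  let ?c = "x powr (\<alpha> + \<beta> - 2) / (Gamma \<alpha> * Gamma \<beta>)"
  have pos: "Gamma \<alpha> > 0" "Gamma \<beta> > 0" "Gamma (\<alpha> + \<beta>) > 0"
    using assms by (auto intro!: Gamma_real_pos)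
  have eq: "?F (0 + x * s) = ?c * ?G s" for s
  proof (cases "0 < s \<and> s < 1")
    case s: True
    have "x - x * s = x * (1 - s)" by (simp add: algebra_simps)
    moreover have "x * s < x" using True s by simp
    moreover have "x powr (\<alpha> - 1) * x powr (\<beta> - 1) = x powr (\<alpha> + \<beta> - 2)"
      by (simp add: powr_add[symmetric] algebra_simps)
    ultimately show ?thesis
      using True s by (simp add: rl_kernel_def powr_mult mult_ac)
  next
    case False
    \<comment> \<open>At \<open>s = 0\<close> and \<open>s = 1\<close> this uses
      \<open>0 powr a = 0\<close>, matching the zero value of the kernel at
      \<open>0\<close>.\<close>
    have "?G s = 0" using False by (auto simp: indicator_def)
    moreover have "?F (0 + x * s) = 0"
    proof (cases "s \<le> 0")
      case True
      then show ?thesis using \<open>x > 0\<close> by (simp add: rl_kernel_def zero_less_mult_iff)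
    next
      case F: False
      then have "x * 1 \<le> x * s" using \<open>x > 0\<close> False by (intro mult_left_mono) auto
      then show ?thesis by (simp add: rl_kernel_def)
    qed
    ultimately show ?thesis by (metis mult_zero_right)
  qed
  have "has_bochner_integral lborel (\<lambda>s. ?F (0 + x * s)) (?c * Beta \<alpha> \<beta>)"
    unfolding eq by (intro has_bochner_integral_mult_right has_bochner_integral_Beta assms)
  then have "has_bochner_integral lborel ?F (\<bar>x\<bar> * (?c * Beta \<alpha> \<beta>))"
    using True lborel_integrable_real_affine_iff[of x ?F 0]
      lborel_integral_real_affine[of x ?F 0]
    by (simp add: has_bochner_integral_iff)
  also have "\<bar>x\<bar> * (?c * Beta \<alpha> \<beta>) = rl_kernel (\<alpha> + \<beta>) x"
  proof -
    have "x * x powr (\<alpha> + \<beta> - 2) = x powr (\<alpha> + \<beta> - 1)"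
      using True powr_mult_base[of x "\<alpha> + \<beta> - 2"] by (simp add: algebra_simps)
    then show ?thesis using True pos by (simp add: rl_kernel_def Beta_def field_simps)
  qed
  finally show ?thesis .
qed

lemma rl_kernel_1: "rl_kernel 1 x = indicator {0<..} x"
  by (simp add: rl_kernel_def)

text \<open>Convolution with the Heaviside kernel \<open>rl_kernel 1\<close> is integration, so this
  is the case of \<open>rl_kernel_conv\<close> with second order \<open>1\<close>.\<close>

lemma rl_kernel_indicator:
  assumes "\<beta> > 0"
  shows "has_bochner_integral lborel (\<lambda>x. rl_kernel \<beta> x * indicator {..<t} x) (rl_kernel (\<beta> + 1) t)"
proof -
  have "rl_kernel 1 (t - x) = indicator {..<t} x" for x
    by (simp add: rl_kernel_1 indicator_def)
  with rl_kernel_conv[OF assms, of 1 t] show ?thesis by simp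
qed

lemma causal_measurable: "causal p \<Longrightarrow> p \<in> borel_measurable borel"
  by (simp add: causal_def)

lemma causal_neg: "causal p \<Longrightarrow> t < 0 \<Longrightarrow> p t = 0"
  by (simp add: causal_def)

lemma causal_diff:
  assumes "causal p" "causal q"
  shows "causal (\<lambda>t. p t - q t)"
  unfolding causal_def
proof (intro conjI allI impI)
  note [measurable] = assms[THEN causal_measurable]
  show "(\<lambda>t. p t - q t) \<in> borel_measurable borel" by measurable
  show "p t - q t = 0" if "t < 0" for t using assms that by (simp add: causal_def)
  fix R
  obtain A B where "\<forall>t\<le>R. \<bar>p t\<bar> \<le> A" "\<forall>t\<le>R. \<bar>q t\<bar> \<le> B"
    using assms unfolding causal_def by meson
  then have "\<forall>t\<le>R. \<bar>p t - q t\<bar> \<le> A + B"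
    by (metis abs_triangle_ineq4 add_mono order_trans)
  then show "\<exists>B. \<forall>t\<le>R. \<bar>p t - q t\<bar> \<le> B" by blast
qed

lemma causal_abs: "causal p \<Longrightarrow> causal (\<lambda>t. \<bar>p t\<bar>)"
  by (auto simp: causal_def)

lemma rl_int_integrable:
  assumes "\<beta> > 0" "causal p"
  shows "integrable lborel (\<lambda>x. rl_kernel \<beta> x * p (t - x))"
proof -
  note [measurable] = causal_measurable[OF assms(2)]
  obtain B where B: "\<forall>s\<le>t. \<bar>p s\<bar> \<le> B"
    using assms unfolding causal_def by meson
  have "integrable lborel (\<lambda>x. B * (rl_kernel \<beta> x * indicator {..<t+1} x))"
    using rl_kernel_indicator[OF assms(1), of "t+1"]
    by (intro integrable_mult_right) (simp add: has_bochner_integral_iff)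
  then show ?thesis
  proof (rule Bochner_Integration.integrable_bound)
    show "AE x in lborel. norm (rl_kernel \<beta> x * p (t - x))
      \<le> norm (B * (rl_kernel \<beta> x * indicator {..<t+1} x))"
    proof (intro AE_I2)
      fix x
      have "\<bar>p (t - x)\<bar> \<le> B * indicator {..<t+1} x \<or> rl_kernel \<beta> x = 0"
      proof (cases "x \<le> 0")
        case True then show ?thesis by (simp add: rl_kernel_def)
      next
        case False
        then show ?thesis using B causal_neg[OF assms(2), of "t - x"]
          by (cases "x < t + 1") auto
      qed
      then show "norm (rl_kernel \<beta> x * p (t - x))
      \<le> norm (B * (rl_kernel \<beta> x * indicator {..<t+1} x))"
        using rl_kernel_nonneg[OF assms(1), of x] order_trans[OF abs_ge_zero, of "p t" B] B
        by (cases "rl_kernel \<beta> x = 0") (auto simp: abs_mult mult.left_commute[of B] intro!: mult_left_mono)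
    qed
  qed measurable
qed

lemma rl_int_nonpos:
  assumes "causal p" "t \<le> 0"
  shows "rl_int \<beta> p t = 0"
proof -
  have "(\<lambda>x. rl_kernel \<beta> x * p (t - x)) = (\<lambda>x. 0)"
    using assms causal_neg[OF assms(1)] by (auto simp: rl_kernel_def)
  then show ?thesis by (simp add: rl_int_def)
qed

lemma rl_int_mono_bound:
  assumes "\<beta> > 0" "causal p" "causal q" "AE s in lborel. s \<le> t \<longrightarrow> \<bar>p s\<bar> \<le> q s"
  shows "\<bar>rl_int \<beta> p t\<bar> \<le> rl_int \<beta> q t"
proof -
  note [measurable] = assms(2,3)[THEN causal_measurable]
  \<comment> \<open>The hypothesis speaks of times \<open>s\<close>, the integral of lags
    \<open>x\<close>; the reflection \<open>s = t - x\<close> preserves null sets.\<close>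
  have "AE x in lborel. t + (-1) * x \<le> t \<longrightarrow> \<bar>p (t + (-1) * x)\<bar> \<le> q (t + (-1) * x)"
    by (rule AE_borel_affine[OF _ _ assms(4)]) (simp, measurable)
  then have AE: "AE x in lborel. \<bar>rl_kernel \<beta> x * p (t - x)\<bar> \<le> rl_kernel \<beta> x * q (t - x)"
  proof eventually_elim
    case (elim x)
    show ?case
    proof (cases "x > 0")
      case True
      then show ?thesis using elim rl_kernel_nonneg[OF assms(1), of x]
        by (auto simp: abs_mult intro!: mult_left_mono)
    qed (simp add: rl_kernel_def)
  qed
  have "\<bar>rl_int \<beta> p t\<bar> \<le> (\<integral>x. \<bar>rl_kernel \<beta> x * p (t - x)\<bar> \<partial>lborel)"
    unfolding rl_int_def by (rule integral_abs_bound)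
  also have "\<dots> \<le> rl_int \<beta> q t"
    unfolding rl_int_def using AE
    by (intro integral_mono_AE integrable_abs rl_int_integrable assms)
  finally show ?thesis .
qed

lemma rl_int_bound:
  assumes "\<beta> > 0" "causal p" "B \<ge> 0" "AE s in lborel. s \<le> t \<longrightarrow> \<bar>p s\<bar> \<le> B"
  shows "\<bar>rl_int \<beta> p t\<bar> \<le> B * rl_kernel (\<beta> + 1) t"
proof -
  \<comment> \<open>A constant is not causal in general. Cutting \<open>B\<close> off at
    \<open>0\<close> costs only the null set \<open>{0}\<close>, since \<open>p\<close> vanishes at
    negative times.\<close>
  let ?q = "\<lambda>s. B * indicator {0<..} s"
  have q: "causal ?q"
    unfolding causal_def
  proof (intro conjI allI impI)
    show "\<exists>B'. \<forall>t\<le>R. \<bar>?q t\<bar> \<le> B'" for R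
      using assms(3) by (intro exI[of _ B]) (auto simp: indicator_def)
  qed auto
  have "\<bar>rl_int \<beta> p t\<bar> \<le> rl_int \<beta> ?q t"
  proof (rule rl_int_mono_bound[OF assms(1,2) q])
    show "AE s in lborel. s \<le> t \<longrightarrow> \<bar>p s\<bar> \<le> ?q s"
      using assms(4) AE_lborel_singleton[of 0]
      by eventually_elim (use causal_neg[OF assms(2)] in \<open>auto simp: indicator_def\<close>)
  qed
  also have "\<dots> = B * rl_kernel (\<beta> + 1) t"
  proof -
    have "indicator {0<..} (t - x) = (indicator {..<t} x :: real)" for x
      by (auto simp: indicator_def)
    then have "rl_int \<beta> ?q t = (\<integral>x. B * (rl_kernel \<beta> x * indicator {..<t} x) \<partial>lborel)"
      by (simp add: rl_int_def mult_ac)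
    then show ?thesis
      using rl_kernel_indicator[OF assms(1), of t] by (simp add: has_bochner_integral_iff)
  qed
  finally show ?thesis .
qed

lemma rl_kernel_mono:
  assumes "\<beta> \<ge> 1" "x \<le> y" shows "rl_kernel \<beta> x \<le> rl_kernel \<beta> y"
proof (cases "x > 0")
  case True
  then show ?thesis using assms Gamma_real_pos[of \<beta>]
    by (auto simp: rl_kernel_def intro!: divide_right_mono powr_mono2)
qed (use assms rl_kernel_nonneg[of \<beta> y] in \<open>auto simp: rl_kernel_def\<close>)

lemma causal_rl_int:
  assumes "\<beta> > 0" "causal p"
  shows "causal (rl_int \<beta> p)"
  unfolding causal_def
proof (intro conjI allI impI)
  note [measurable] = causal_measurable[OF assms(2)]
  show "rl_int \<beta> p \<in> borel_measurable borel"
    unfolding rl_int_def[abs_def] by measurable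
  show "rl_int \<beta> p t = 0" if "t < 0" for t using rl_int_nonpos[OF assms(2)] that by simp
  fix R
  obtain B where B: "\<forall>s\<le>R. \<bar>p s\<bar> \<le> B"
    using assms unfolding causal_def by meson
  then have "B \<ge> 0" by (meson abs_ge_zero order.trans order_refl)
  have "\<bar>rl_int \<beta> p t\<bar> \<le> B * rl_kernel (\<beta> + 1) R" if "t \<le> R" for t
  proof -
    have "\<bar>rl_int \<beta> p t\<bar> \<le> B * rl_kernel (\<beta> + 1) t"
      using B that by (intro rl_int_bound assms \<open>B \<ge> 0\<close>) auto
    also have "\<dots> \<le> B * rl_kernel (\<beta> + 1) R"
      using assms(1) that \<open>B \<ge> 0\<close> by (intro mult_left_mono rl_kernel_mono) auto
    finally show ?thesis .
  qed
  then show "\<exists>B. \<forall>t\<le>R. \<bar>rl_int \<beta> p t\<bar> \<le> B" by blast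
qed

lemma rl_int_diff:
  assumes "\<beta> > 0" "causal p" "causal q"
  shows "rl_int \<beta> (\<lambda>t. p t - q t) t = rl_int \<beta> p t - rl_int \<beta> q t"
  unfolding rl_int_def right_diff_distrib
  by (intro Bochner_Integration.integral_diff rl_int_integrable assms)

text \<open>Parametrise by the total lag \<open>z\<close> and the part \<open>x\<close> of it taken
  by the outer kernel. After Fubini the inner integral over \<open>x\<close> is the kernel
  convolution, while \<open>p (t - z)\<close> is a constant factor.\<close>

lemma rl_int_semigroup:
  assumes "\<alpha> > 0" "\<beta> > 0" "causal p"
  shows "rl_int \<alpha> (rl_int \<beta> p) t = rl_int (\<alpha> + \<beta>) p t"
proof -
  note [measurable] = causal_measurable[OF assms(3)]
  let ?F = "\<lambda>z x. rl_kernel \<alpha> x * rl_kernel \<beta> (z - x) * p (t - z)"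
  have F: "has_bochner_integral lborel (?F z) (rl_kernel (\<alpha> + \<beta>) z * p (t - z))" for z
    by (intro has_bochner_integral_mult_left rl_kernel_conv assms)
  have F': "has_bochner_integral lborel (\<lambda>x. \<bar>?F z x\<bar>) (rl_kernel (\<alpha> + \<beta>) z * \<bar>p (t - z)\<bar>)" for z
    using has_bochner_integral_mult_left[OF rl_kernel_conv[OF assms(1,2), of z], of "\<bar>p (t - z)\<bar>"]
    by (simp add: abs_mult rl_kernel_nonneg assms)
  \<comment> \<open>Absolute integrability follows from the same convolution: the kernels are
    nonnegative, so taking absolute values only replaces \<open>p\<close> by
    \<open>\<bar>p\<bar>\<close>.\<close>
  have int: "integrable (lborel \<Otimes>\<^sub>M lborel) (\<lambda>(z, x). ?F z x)"
  proof (rule lborel_pair.Fubini_integrable)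
    show "integrable lborel (\<lambda>z. LINT x|lborel. norm (case (z, x) of (z, x) \<Rightarrow> ?F z x))"
      using F' rl_int_integrable[OF _ causal_abs[OF assms(3)], of "\<alpha> + \<beta>" t] assms
      by (simp add: has_bochner_integral_iff)
    show "AE z in lborel. integrable lborel (\<lambda>x. case (z, x) of (z, x) \<Rightarrow> ?F z x)"
      using F by (simp add: has_bochner_integral_iff)
  qed measurable
  have "rl_int \<beta> p (t - x) = (\<integral>z. rl_kernel \<beta> (z - x) * p (t - z) \<partial>lborel)" for x
    unfolding rl_int_def
    using lborel_integral_real_affine[of 1 "\<lambda>y. rl_kernel \<beta> y * p (t - x - y)" "-x"] by simp
  then have "rl_int \<alpha> (rl_int \<beta> p) t = (\<integral>x. (\<integral>z. ?F z x \<partial>lborel) \<partial>lborel)"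
    by (subst rl_int_def) (simp add: mult.assoc)
  also have "\<dots> = (\<integral>z. (\<integral>x. ?F z x \<partial>lborel) \<partial>lborel)"
    using lborel_pair.Fubini_integral[OF int] by simp
  also have "\<dots> = rl_int (\<alpha> + \<beta>) p t"
    unfolding rl_int_def using has_bochner_integral_integral_eq[OF F] by (intro Bochner_Integration.integral_cong) auto
  finally show ?thesis .
qed

lemma rl_int_1: "rl_int 1 p t = (\<integral>s. indicator {..<t} s * p s \<partial>lborel)"
  using lborel_integral_real_affine[of "-1" "\<lambda>s. indicator {..<t} s * p s" t]
  by (simp add: rl_int_def rl_kernel_1 indicator_def)

lemma causal_integrable:
  assumes "causal p"
  shows "integrable lborel (\<lambda>s. indicator {..<t} s * p s)"
proof -
  have "(\<lambda>x. rl_kernel 1 x * p (t - x)) = (\<lambda>x. indicator {..<t} (t + (-1) * x) * p (t + (-1) * x))"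
    by (auto simp: rl_kernel_1 indicator_def)
  then show ?thesis
    using rl_int_integrable[of 1 p t] assms
      lborel_integrable_real_affine_iff[of "-1" "\<lambda>s. indicator {..<t} s * p s" t] by simp
qed

section \<open>Shifted kernels and Hoelder continuity\<close>

text \<open>Keeps the lag measured from \<open>t\<close>, so that the values at
  \<open>t - \<epsilon>\<close> and at \<open>t\<close> become integrals of two kernels against the
  same function and can be subtracted.\<close>

lemma rl_int_shift:
  "rl_int \<beta> p (t - \<epsilon>) = (\<integral>x. rl_kernel \<beta> (x - \<epsilon>) * p (t - x) \<partial>lborel)"
  unfolding rl_int_def
  using lborel_integral_real_affine[of 1 "\<lambda>y. rl_kernel \<beta> y * p (t - \<epsilon> - y)" "-\<epsilon>"] by simp

lemma rl_int_cong:
  assumes "\<And>s. s \<le> t \<Longrightarrow> p s = q s"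
  shows "rl_int \<beta> p t = rl_int \<beta> q t"
  unfolding rl_int_def
  by (intro Bochner_Integration.integral_cong) (auto simp: rl_kernel_def assms)

lemma rl_kernel_shift_indicator:
  assumes "\<beta> > 0"
  shows "has_bochner_integral lborel (\<lambda>x. rl_kernel \<beta> (x - \<epsilon>) * indicator {..<t} x) (rl_kernel (\<beta> + 1) (t - \<epsilon>))"
proof -
  have "indicator {..<t - \<epsilon>} (- \<epsilon> + 1 * x) = (indicator {..<t} x :: real)" for x
    by (auto simp: indicator_def)
  then show ?thesis
    using rl_kernel_indicator[OF assms, of "t - \<epsilon>"]
      lborel_integral_real_affine[of 1 "\<lambda>x. rl_kernel \<beta> x * indicator {..<t - \<epsilon>} x" "-\<epsilon>"]
      lborel_integrable_real_affine_iff[of 1 "\<lambda>x. rl_kernel \<beta> x * indicator {..<t - \<epsilon>} x" "-\<epsilon>"]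
    by (simp add: has_bochner_integral_iff)
qed

lemma rl_kernel_antimono:
  assumes "0 < \<beta>" "\<beta> \<le> 1" "0 < x" "x \<le> y"
  shows "rl_kernel \<beta> y \<le> rl_kernel \<beta> x"
  using assms Gamma_real_pos[of \<beta>]
  by (auto simp: rl_kernel_def intro!: divide_right_mono powr_mono2')

text \<open>For lags above \<open>\<epsilon> = t - t'\<close> the shifted kernel dominates, because
  the kernel is decreasing; for smaller lags it vanishes. So the absolute kernel difference
  integrates to a difference of masses plus twice the mass up to \<open>\<epsilon>\<close>, and the
  first difference is not positive.\<close>

lemma rl_int_holder:
  assumes "0 < \<beta>" "\<beta> \<le> 1" "causal p" "B \<ge> 0" "AE s in lborel. s \<le> t \<longrightarrow> \<bar>p s\<bar> \<le> B" "t' \<le> t"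
  shows "\<bar>rl_int \<beta> p t - rl_int \<beta> p t'\<bar> \<le> 2 * B * rl_kernel (\<beta> + 1) (t - t')"
proof -
  note [measurable] = assms(3)[THEN causal_measurable]
  define \<epsilon> where "\<epsilon> = t - t'"
  have \<epsilon>: "\<epsilon> \<ge> 0" "t' = t - \<epsilon>" using assms by (auto simp: \<epsilon>_def)
  let ?k = "rl_kernel \<beta>"
  \<comment> \<open>The last term counts \<open>?k x\<close> twice below \<open>\<epsilon>\<close>:
    once to cancel \<open>- ?k x\<close>, once as the bound itself.\<close>
  let ?g = "\<lambda>x. B * ((?k (x - \<epsilon>) * indicator {..<t} x - ?k x * indicator {..<t} x) + 2 * (?k x * indicator {..<\<epsilon>} x))"
  have int1: "integrable lborel (\<lambda>x. ?k x * p (t - x))"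
    by (intro rl_int_integrable assms)
  have int2: "integrable lborel (\<lambda>x. ?k (x - \<epsilon>) * p (t - x))"
    using lborel_integrable_real_affine_iff[of 1 "\<lambda>x. ?k x * p (t - \<epsilon> - x)" "-\<epsilon>"]
      rl_int_integrable[OF assms(1,3), of "t - \<epsilon>"] by simp
  have intg: "has_bochner_integral lborel ?g
      (B * ((rl_kernel (\<beta> + 1) (t - \<epsilon>) - rl_kernel (\<beta> + 1) t) + 2 * rl_kernel (\<beta> + 1) \<epsilon>))"
    by (intro has_bochner_integral_mult_right has_bochner_integral_add has_bochner_integral_diff
        rl_kernel_indicator rl_kernel_shift_indicator assms)
  have "AE x in lborel. t + (-1) * x \<le> t \<longrightarrow> \<bar>p (t + (-1) * x)\<bar> \<le> B"
    by (rule AE_borel_affine[OF _ _ assms(5)]) (simp, measurable)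
  then have AE: "AE x in lborel. \<bar>?k x * p (t - x) - ?k (x - \<epsilon>) * p (t - x)\<bar> \<le> ?g x"
    using AE_lborel_singleton[of t] AE_lborel_singleton[of \<epsilon>]
  proof eventually_elim
    case (elim x)
    have nn: "?k x \<ge> 0" "?k (x - \<epsilon>) \<ge> 0" by (intro rl_kernel_nonneg assms)+
    consider "x \<le> 0" | "x > t" | "0 < x" "x < t" "x < \<epsilon>" | "0 < x" "x < t" "x > \<epsilon>"
      using elim by fastforce
    then show ?case
    proof cases
      case 1
      then show ?thesis using \<epsilon> by (simp add: rl_kernel_def)
    next
      case 2
      then show ?thesis using nn \<open>B \<ge> 0\<close> causal_neg[OF assms(3), of "t - x"] by simp
    next
      case 3
      then have "?k (x - \<epsilon>) = 0" by (simp add: rl_kernel_def)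
      then show ?thesis using 3 nn elim mult_left_mono[of "\<bar>p (t - x)\<bar>" B "?k x"]
        by (simp add: abs_mult mult.commute[of B])
    next
      case 4
      have "?k x \<le> ?k (x - \<epsilon>)"
        using 4 \<epsilon> assms by (intro rl_kernel_antimono) auto
      moreover have "\<bar>?k x * p (t - x) - ?k (x - \<epsilon>) * p (t - x)\<bar> = \<bar>?k x - ?k (x - \<epsilon>)\<bar> * \<bar>p (t - x)\<bar>"
        by (simp add: abs_mult[symmetric] algebra_simps)
      moreover have "\<bar>?k x - ?k (x - \<epsilon>)\<bar> * \<bar>p (t - x)\<bar> \<le> \<bar>?k x - ?k (x - \<epsilon>)\<bar> * B"
        using 4 elim by (intro mult_left_mono) auto
      ultimately show ?thesis using 4 by (simp add: mult.commute)
    qed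
  qed
  have "rl_int \<beta> p t - rl_int \<beta> p t' = (\<integral>x. ?k x * p (t - x) - ?k (x - \<epsilon>) * p (t - x) \<partial>lborel)"
    unfolding \<epsilon>(2) rl_int_shift
    by (subst Bochner_Integration.integral_diff[OF int1 int2]) (simp add: rl_int_def)
  then have "\<bar>rl_int \<beta> p t - rl_int \<beta> p t'\<bar> \<le> (\<integral>x. \<bar>?k x * p (t - x) - ?k (x - \<epsilon>) * p (t - x)\<bar> \<partial>lborel)"
    by (simp add: integral_abs_bound)
  also have "\<dots> \<le> (\<integral>x. ?g x \<partial>lborel)"
    using AE int1 int2 intg
    by (intro integral_mono_AE integrable_abs Bochner_Integration.integrable_diff) (auto simp: has_bochner_integral_iff)
  also have "\<dots> = B * ((rl_kernel (\<beta> + 1) (t - \<epsilon>) - rl_kernel (\<beta> + 1) t) + 2 * rl_kernel (\<beta> + 1) \<epsilon>)"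
    using intg by (simp add: has_bochner_integral_iff)
  also have "\<dots> \<le> B * (0 + 2 * rl_kernel (\<beta> + 1) \<epsilon>)"
    using rl_kernel_mono[of "\<beta> + 1" "t - \<epsilon>" t] assms \<epsilon> by (intro mult_left_mono add_right_mono) auto
  finally show ?thesis by (simp add: \<epsilon>_def)
qed

lemma isCont_rl_int:
  assumes "0 < \<beta>" "\<beta> \<le> 1" "causal p"
  shows "isCont (rl_int \<beta> p) t"
proof -
  obtain B where B: "\<forall>s\<le>t+1. \<bar>p s\<bar> \<le> B"
    using assms unfolding causal_def by meson
  then have "B \<ge> 0" using order_trans[OF abs_ge_zero, of "p t" B] by auto
  have G: "Gamma (\<beta> + 1) \<noteq> 0" using Gamma_real_pos[of "\<beta> + 1"] assms(1) by linarith
  have K: "((\<lambda>s. 2 * B * (\<bar>s - t\<bar> powr \<beta> / Gamma (\<beta> + 1))) \<longlongrightarrow> 2 * B * (\<bar>t - t\<bar> powr \<beta> / Gamma (\<beta> + 1))) (at t)"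
    by (intro tendsto_intros tendsto_powr') (use assms G in auto)
  have "((\<lambda>s. rl_int \<beta> p s - rl_int \<beta> p t) \<longlongrightarrow> 0) (at t)"
  proof (rule Lim_null_comparison)
    show "((\<lambda>s. 2 * B * (\<bar>s - t\<bar> powr \<beta> / Gamma (\<beta> + 1))) \<longlongrightarrow> 0) (at t)"
      using K by simp
    have bd: "\<bar>rl_int \<beta> p x - rl_int \<beta> p y\<bar> \<le> 2 * B * (\<bar>x - y\<bar> powr \<beta> / Gamma (\<beta> + 1))"
      if "y < x" "x \<le> t + 1" for x y
      using rl_int_holder[OF assms \<open>B \<ge> 0\<close>, of x y] B that by (auto simp: rl_kernel_def)
    have "\<forall>\<^sub>F s in at t. s < t + 1"
      by (intro order_tendstoD(2)[OF tendsto_ident_at]) simp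
    moreover have "\<forall>\<^sub>F s in at t. s \<noteq> t" by (simp add: eventually_at_filter)
    ultimately show "\<forall>\<^sub>F s in at t. norm (rl_int \<beta> p s - rl_int \<beta> p t) \<le> 2 * B * (\<bar>s - t\<bar> powr \<beta> / Gamma (\<beta> + 1))"
    proof eventually_elim
      case (elim s)
      then consider "s < t" | "t < s" by linarith
      then show ?case
      proof cases
        case 1
        then show ?thesis using bd[of s t] by (simp add: abs_minus_commute)
      qed (use bd[of t s] elim in simp)
    qed
  qed
  then show ?thesis unfolding isCont_def by (rule LIM_zero_cancel)
qed

section \<open>Inverting the fractional integral\<close>

text \<open>The positive and negative parts of \<open>h\<close> are densities of two measures that
  agree on all half-lines \<open>{x<..}\<close>, hence agree; densities are unique almost
  everywhere.\<close>

lemma AE_zero_if_integral_Ioi_zero: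
  fixes h :: "real \<Rightarrow> real"
  assumes h: "integrable lborel h"
    and zero: "\<And>x. (\<integral>t. indicator {x<..} t * h t \<partial>lborel) = 0"
  shows "AE t in lborel. h t = 0"
proof -
  note [measurable] = borel_measurable_integrable[OF h]
  let ?P = "\<lambda>t. max 0 (h t)" and ?N = "\<lambda>t. max 0 (- h t)"
  have P: "integrable lborel ?P" and N: "integrable lborel ?N"
    using h by auto
  have em: "emeasure (density lborel (\<lambda>t. ennreal (q t))) {x<..} = ennreal (\<integral>t. indicator {x<..} t * q t \<partial>lborel)"
    if q: "integrable lborel q" "\<And>t. q t \<ge> 0" for q :: "real \<Rightarrow> real" and x
  proof -
    note [measurable] = borel_measurable_integrable[OF q(1)]
    have "emeasure (density lborel (\<lambda>t. ennreal (q t))) {x<..} = (\<integral>\<^sup>+t. ennreal (indicator {x<..} t * q t) \<partial>lborel)"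
      by (subst emeasure_density) (auto intro!: nn_integral_cong simp: indicator_def)
    also have "\<dots> = ennreal (\<integral>t. indicator {x<..} t * q t \<partial>lborel)"
      using integrable_mult_indicator[OF _ q(1), of "{x<..}"] q
      by (intro nn_integral_eq_integral) auto
    finally show ?thesis .
  qed
  have eq: "(\<integral>t. indicator {x<..} t * ?P t \<partial>lborel) = (\<integral>t. indicator {x<..} t * ?N t \<partial>lborel)" for x
  proof -
    have "(\<integral>t. indicator {x<..} t * ?P t \<partial>lborel) - (\<integral>t. indicator {x<..} t * ?N t \<partial>lborel)
      = (\<integral>t. indicator {x<..} t * ?P t - indicator {x<..} t * ?N t \<partial>lborel)"
      using integrable_mult_indicator[OF _ P, of "{x<..}"] integrable_mult_indicator[OF _ N, of "{x<..}"]
      by (intro Bochner_Integration.integral_diff[symmetric]) auto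
    also have "\<dots> = (\<integral>t. indicator {x<..} t * h t \<partial>lborel)"
      by (intro Bochner_Integration.integral_cong) (auto simp: indicator_def max_def)
    finally show ?thesis using zero by simp
  qed
  have "density lborel (\<lambda>t. ennreal (?P t)) = density lborel (\<lambda>t. ennreal (?N t))"
    by (rule measure_eqI_lessThan) (auto simp: em[OF P] em[OF N] eq)
  then have "AE t in lborel. ennreal (?P t) = ennreal (?N t)"
    by (intro sigma_finite_measure.density_unique[OF sigma_finite_lborel]) auto
  then show ?thesis
    by eventually_elim (auto simp: max_def split: if_splits)
qed

text \<open>Applying \<open>rl_int \<gamma>\<close> to the hypothesis gives
  \<open>rl_int 1 U = rl_int 1 (rl_int \<gamma> H)\<close> up to \<open>R\<close>. Equal primitives
  determine the integrands only almost everywhere.\<close>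

lemma rl_int_inversion:
  assumes \<gamma>: "0 < \<gamma>" "\<gamma> < 1" and U: "causal U" and H: "causal H"
    and eq: "\<And>t. t \<le> R \<Longrightarrow> rl_int (1 - \<gamma>) U t = rl_int 1 H t"
  shows "AE t in lborel. t < R \<longrightarrow> U t = rl_int \<gamma> H t"
proof -
  have V: "causal (rl_int \<gamma> H)" by (intro causal_rl_int \<gamma> H)
  define D where "D = (\<lambda>t. U t - rl_int \<gamma> H t)"
  have D: "causal D" unfolding D_def by (intro causal_diff U V)
  note [measurable] = causal_measurable[OF D]
  have int: "integrable lborel (\<lambda>s. indicator {..<t} s * D s)" for t
    by (intro causal_integrable D)
  have D0: "(\<integral>s. indicator {..<t} s * D s \<partial>lborel) = 0" if "t \<le> R" for t
  proof -
    have "rl_int 1 U t = rl_int \<gamma> (rl_int (1 - \<gamma>) U) t"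
      using rl_int_semigroup[of \<gamma> "1 - \<gamma>" U t] \<gamma> U by simp
    also have "\<dots> = rl_int \<gamma> (rl_int 1 H) t"
      using that by (intro rl_int_cong eq) auto
    also have "\<dots> = rl_int 1 (rl_int \<gamma> H) t"
      using rl_int_semigroup[of \<gamma> 1 H t] rl_int_semigroup[of 1 \<gamma> H t] \<gamma> H by (simp add: add.commute)
    finally have "rl_int 1 D t = 0"
      unfolding D_def by (subst rl_int_diff[OF _ U V]) auto
    then show ?thesis by (simp add: rl_int_1)
  qed
  have "AE t in lborel. indicator {..<R} t * D t = 0"
  proof (rule AE_zero_if_integral_Ioi_zero[OF int])
    fix x
    show "(\<integral>t. indicator {x<..} t * (indicator {..<R} t * D t) \<partial>lborel) = 0"
    proof (cases "x < R")
      case False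
      then have "indicator {x<..} t * (indicator {..<R} t * D t) = 0" for t by (auto simp: indicator_def)
      then have "(\<lambda>t. indicator {x<..} t * (indicator {..<R} t * D t)) = (\<lambda>t. 0)" by blast
      then show ?thesis by (simp only: integral_zero)
    next
      case True
      have "(\<integral>t. indicator {x<..} t * (indicator {..<R} t * D t) \<partial>lborel)
        = (\<integral>t. indicator {..<R} t * D t - indicator {..<x} t * D t \<partial>lborel)"
        by (intro integral_cong_AE) (use AE_lborel_singleton[of x] True in \<open>auto elim!: eventually_mono simp: indicator_def\<close>)
      also have "\<dots> = 0"
        using True by (subst Bochner_Integration.integral_diff[OF int int]) (auto simp: D0)
      finally show ?thesis .
    qed
  qed
  then show ?thesis
    by eventually_elim (auto simp: D_def)
qed

section \<open>A Gronwall inequality for fractional integrals\<close>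

text \<open>Scaling by \<open>\<mu>\<close> reduces this to the Gamma integral. The value bounds the
  norm of \<open>rl_int \<gamma>\<close> on functions weighted by \<open>exp (- \<mu> t)\<close>,
  and it is small for large \<open>\<mu>\<close>.\<close>

lemma rl_kernel_Laplace:
  assumes "0 < \<gamma>" "0 < \<mu>"
  shows "has_bochner_integral lborel (\<lambda>x. rl_kernel \<gamma> x * exp (- (\<mu> * x))) (\<mu> powr (- \<gamma>))"
proof -
  let ?F = "\<lambda>x. rl_kernel \<gamma> x * exp (- (\<mu> * x))"
  let ?G = "\<lambda>t. indicator {0..} t * t powr (\<gamma> - 1) / exp t :: real"
  have pos: "Gamma \<gamma> > 0" using assms by (intro Gamma_real_pos)
  have "has_bochner_integral lborel ?G (Gamma \<gamma>)"
    using pos Gamma_conv_nn_integral_real[OF assms(1)]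
    by (intro has_bochner_integral_nn_integral) auto
  then have G: "has_bochner_integral lborel (\<lambda>x. ?G (0 + \<mu> * x)) (Gamma \<gamma> / \<mu>)"
    using assms lborel_integrable_real_affine_iff[of \<mu> ?G 0]
      lborel_integral_real_affine[of \<mu> ?G 0]
    by (simp add: has_bochner_integral_iff field_simps)
  have "?F x = (\<mu> powr (1 - \<gamma>) / Gamma \<gamma>) * ?G (0 + \<mu> * x)" for x
  proof (cases "x > 0")
    case True
    have "\<mu> powr (1 - \<gamma>) * \<mu> powr (\<gamma> - 1) = 1"
      using assms by (simp add: powr_add[symmetric])
    then show ?thesis using True assms by (simp add: rl_kernel_def powr_mult exp_minus field_simps)
  next
    case False
    have "x = 0 \<or> \<not> 0 \<le> \<mu> * x"
      using False assms by (auto simp: zero_le_mult_iff)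
    then show ?thesis using False by (auto simp: rl_kernel_def)
  qed
  then have "has_bochner_integral lborel ?F (\<mu> powr (1 - \<gamma>) / Gamma \<gamma> * (Gamma \<gamma> / \<mu>))"
    by (simp only:) (intro has_bochner_integral_mult_right G)
  also have "\<mu> powr (1 - \<gamma>) / Gamma \<gamma> * (Gamma \<gamma> / \<mu>) = \<mu> powr (- \<gamma>)"
    using less_imp_neq[OF pos, symmetric] assms by (simp add: powr_diff powr_minus divide_simps)
  finally show ?thesis .
qed

text \<open>In the sup norm weighted by \<open>exp (- \<mu> t)\<close> the operator
  \<open>L * rl_int \<gamma>\<close> has norm at most \<open>L * \<mu> powr (- \<gamma>)\<close>,
  hence at most \<open>1 / 2\<close>. The final \<open>2 * c\<close> is the sum of the series
  \<open>c + c / 2 + c / 4 + ...\<close>.\<close>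

lemma fractional_Gronwall:
  assumes \<gamma>: "0 < \<gamma>" and \<mu>: "0 < \<mu>" and L: "0 \<le> L" "2 * L \<le> \<mu> powr \<gamma>" and c: "0 \<le> c" and w: "causal w"
    and le: "AE t in lborel. 0 \<le> t \<and> t \<le> R \<longrightarrow> \<bar>w t\<bar> \<le> c + L * rl_int \<gamma> (\<lambda>s. \<bar>w s\<bar>) t"
  shows "AE t in lborel. 0 \<le> t \<and> t \<le> R \<longrightarrow> \<bar>w t\<bar> \<le> 2 * c * exp (\<mu> * t)"
proof -
  obtain B where B: "\<forall>t\<le>R. \<bar>w t\<bar> \<le> B" using w unfolding causal_def by meson
  have B0: "B \<ge> 0" using B[rule_format, of R] by simp
  have step: "rl_int \<gamma> (\<lambda>s. \<bar>w s\<bar>) t \<le> b * exp (\<mu> * t) * \<mu> powr (- \<gamma>)"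
    if AE: "AE s in lborel. 0 \<le> s \<and> s \<le> R \<longrightarrow> \<bar>w s\<bar> \<le> b * exp (\<mu> * s)" and "b \<ge> 0" "t \<le> R" for b t
  proof -
    let ?q = "\<lambda>s. b * exp (\<mu> * s) * indicator {0..} s"
    have q: "causal ?q"
      unfolding causal_def
    proof (intro conjI allI impI)
      fix R'
      show "\<exists>B. \<forall>t\<le>R'. \<bar>?q t\<bar> \<le> B"
        using \<open>b \<ge> 0\<close> \<mu> by (intro exI[of _ "b * exp (\<mu> * R')"]) (auto simp: indicator_def intro!: mult_left_mono)
    qed auto
    have "\<bar>rl_int \<gamma> (\<lambda>s. \<bar>w s\<bar>) t\<bar> \<le> rl_int \<gamma> ?q t"
      using AE
      by (intro rl_int_mono_bound \<gamma> causal_abs w q, eventually_elim)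
        (use causal_neg[OF w] \<open>t \<le> R\<close> in \<open>auto simp: indicator_def\<close>)
    \<comment> \<open>Dropping the cutoff at lag \<open>t\<close> turns the truncated integral into
      the full Laplace transform.\<close>
    also have "rl_int \<gamma> ?q t \<le> (\<integral>x. b * exp (\<mu> * t) * (rl_kernel \<gamma> x * exp (- (\<mu> * x))) \<partial>lborel)"
      unfolding rl_int_def
    proof (rule integral_mono)
      show "integrable lborel (\<lambda>x. b * exp (\<mu> * t) * (rl_kernel \<gamma> x * exp (- (\<mu> * x))))"
        using rl_kernel_Laplace[OF \<gamma> \<mu>] by (intro integrable_mult_right) (simp add: has_bochner_integral_iff)
      fix x
      have "exp (\<mu> * (t - x)) = exp (\<mu> * t) * exp (- (\<mu> * x))"
        by (simp add: exp_add[symmetric] algebra_simps)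
      then show "rl_kernel \<gamma> x * ?q (t - x) \<le> b * exp (\<mu> * t) * (rl_kernel \<gamma> x * exp (- (\<mu> * x)))"
        using rl_kernel_nonneg[OF \<gamma>, of x] \<open>b \<ge> 0\<close> by (simp add: indicator_def mult_ac)
    qed (intro rl_int_integrable \<gamma> q)
    also have "\<dots> = b * exp (\<mu> * t) * \<mu> powr (- \<gamma>)"
      using rl_kernel_Laplace[OF \<gamma> \<mu>] by (simp add: has_bochner_integral_iff)
    finally show ?thesis by linarith
  qed
  have L': "L * \<mu> powr (- \<gamma>) \<le> 1 / 2"
    using L \<mu> by (simp add: powr_minus field_simps)
  \<comment> \<open>For the norm weighted by \<open>exp (- \<mu> t)\<close>, each use of the inequality halves the excess over \<open>2 c\<close>.\<close>
  have "AE t in lborel. 0 \<le> t \<and> t \<le> R \<longrightarrow> \<bar>w t\<bar> \<le> (2 * c + B / 2 ^ n) * exp (\<mu> * t)" for n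
  proof (induction n)
    case 0
    have "B * 1 \<le> (2 * c + B) * exp (\<mu> * t)" if "t \<ge> 0" for t
      using that \<mu> B0 c by (intro mult_mono) auto
    then show ?case using B by (auto intro!: AE_I2 intro: order_trans)
  next
    case (Suc n)
    from le show ?case
    proof eventually_elim
      case (elim t)
      show ?case
      proof
        assume t: "0 \<le> t \<and> t \<le> R"
        let ?b = "2 * c + B / 2 ^ n"
        have b: "?b \<ge> 0" using B0 c by simp
        have "\<bar>w t\<bar> \<le> c + L * rl_int \<gamma> (\<lambda>s. \<bar>w s\<bar>) t" using elim t by simp
        also have "\<dots> \<le> c + L * (?b * exp (\<mu> * t) * \<mu> powr (- \<gamma>))"
          using step[OF Suc b] t L by (intro add_left_mono mult_left_mono) auto
        also have "\<dots> = c * 1 + (L * \<mu> powr (- \<gamma>)) * (?b * exp (\<mu> * t))" by (simp add: mult_ac)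
        also have "\<dots> \<le> c * exp (\<mu> * t) + 1 / 2 * (?b * exp (\<mu> * t))"
          using t \<mu> c b by (intro add_mono mult_left_mono mult_right_mono L') auto
        also have "\<dots> = (2 * c + B / 2 ^ Suc n) * exp (\<mu> * t)"
          by (simp add: field_simps)
        finally show "\<bar>w t\<bar> \<le> (2 * c + B / 2 ^ Suc n) * exp (\<mu> * t)" .
      qed
    qed
  qed
  \<comment> \<open>Countably many null sets are united before the limit in \<open>n\<close> is
    taken at a fixed \<open>t\<close>.\<close>
  then have "AE t in lborel. \<forall>n. 0 \<le> t \<and> t \<le> R \<longrightarrow> \<bar>w t\<bar> \<le> (2 * c + B / 2 ^ n) * exp (\<mu> * t)"
    unfolding AE_all_countable by blast
  then show ?thesis
  proof eventually_elim
    case (elim t)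
    have "(\<lambda>n. (2 * c + B * (1 / 2) ^ n) * exp (\<mu> * t)) \<longlonglongrightarrow> (2 * c + B * 0) * exp (\<mu> * t)"
      by (intro tendsto_intros LIMSEQ_power_zero) auto
    moreover have "(\<lambda>n. (2 * c + B * (1 / 2) ^ n) * exp (\<mu> * t)) = (\<lambda>n. (2 * c + B / 2 ^ n) * exp (\<mu> * t))"
      by (simp add: power_one_over)
    ultimately have "(\<lambda>n. (2 * c + B / 2 ^ n) * exp (\<mu> * t)) \<longlonglongrightarrow> 2 * c * exp (\<mu> * t)" by simp
    then show ?case
      using elim LIMSEQ_le_const[of _ "2 * c * exp (\<mu> * t)" "\<bar>w t\<bar>"] by blast
  qed
qed

section \<open>Positivity for linear Volterra equations\<close>

text \<open>For a suitable fixed \<open>N\<close>, the term \<open>c * \<epsilon>\<close> makes each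
  block \<open>{x<..N * x}\<close> contribute at least \<open>c / 2\<close> to the integral of
  \<open>P x / x\<close>, so that integral exceeds every bound as \<open>\<epsilon>\<close> shrinks.
  The other term, together with \<open>P x \<le> D\<close>, bounds it by
  \<open>D / \<gamma>\<close>.\<close>

lemma log_divergence:
  fixes P :: "real \<Rightarrow> real"
  assumes [measurable]: "P \<in> borel_measurable borel"
    and P: "\<And>x. 0 \<le> P x" "\<And>x. P x \<le> D"
    and pos: "c > 0" "\<gamma> > 0" "e > 0"
    and ge: "\<And>\<epsilon>. \<lbrakk>0 < \<epsilon>; \<epsilon> \<le> e\<rbrakk> \<Longrightarrow>
       (\<integral>x. indicator {0<..\<epsilon>} x * P x \<partial>lborel) \<ge> c * \<epsilon> + \<gamma> * \<epsilon> * (\<integral>x. indicator {\<epsilon><..e} x * (P x / x) \<partial>lborel)"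
  shows False
proof -
  define A where "A \<epsilon> = (\<integral>x. indicator {0<..\<epsilon>} x * P x \<partial>lborel)" for \<epsilon>
  define Q where "Q \<epsilon> = (\<integral>x. indicator {\<epsilon><..e} x * (P x / x) \<partial>lborel)" for \<epsilon>
  have D0: "D \<ge> 0" using P[of 0] by linarith
  have intP: "integrable lborel (\<lambda>x. indicator {a<..b} x * P x)" for a b
  proof (rule Bochner_Integration.integrable_bound)
    show "integrable lborel (\<lambda>x. D * indicator {a..b} x)"
      by (intro integrable_mult_right integrable_real_indicator) (auto simp: emeasure_lborel_Icc_eq)
  qed (use P D0 in \<open>auto simp: indicator_def\<close>)
  have intQ: "integrable lborel (\<lambda>x. indicator {a<..b} x * (P x / x))" if "a > 0" for a b
  proof (rule Bochner_Integration.integrable_bound)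
    show "integrable lborel (\<lambda>x. D / a * indicator {a..b} x)"
      by (intro integrable_mult_right integrable_real_indicator) (auto simp: emeasure_lborel_Icc_eq)
    show "AE x in lborel. norm (indicator {a<..b} x * (P x / x)) \<le> norm (D / a * indicator {a..b} x)"
      using P D0 that by (intro AE_I2) (auto simp: indicator_def intro!: frac_le)
  qed auto
  have Q0: "Q \<epsilon> \<ge> 0" if "\<epsilon> > 0" for \<epsilon>
    unfolding Q_def using P that by (intro Bochner_Integration.integral_nonneg) (auto simp: indicator_def)
  have A_le: "A \<epsilon> \<le> D * \<epsilon>" if "\<epsilon> > 0" for \<epsilon>
  proof -
    have "A \<epsilon> \<le> (\<integral>x. D * indicator {0..\<epsilon>} x \<partial>lborel)"
      unfolding A_def using P D0
      by (intro integral_mono intP integrable_mult_right integrable_real_indicator)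
         (auto simp: indicator_def emeasure_lborel_Icc_eq)
    then show ?thesis using that by simp
  qed
  have A_ge: "A \<epsilon> \<ge> c * \<epsilon> + \<gamma> * \<epsilon> * Q \<epsilon>" if "0 < \<epsilon>" "\<epsilon> \<le> e" for \<epsilon>
    using ge[OF that] by (simp add: A_def Q_def)
  \<comment> \<open>The mass of \<open>P\<close> up to \<open>x\<close> is at most
    \<open>D * x\<close>; \<open>N \<ge> 2 * D / c\<close> makes this at most half of
    \<open>c * (N * x)\<close>.\<close>
  obtain N0 :: nat where N0: "2 * D / c < N0" using reals_Archimedean2 by blast
  define N where "N = N0 + 1"
  have N: "N \<ge> 1" "2 * D / c \<le> N" using N0 by (auto simp: N_def)
  have indicator_Ioc_diff: "indicator {b<..d} y = (indicator {a<..d} y - indicator {a<..b} y :: real)"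
    and indicator_Ioc_diff': "indicator {a<..b} y = (indicator {a<..d} y - indicator {b<..d} y :: real)"
    if "a \<le> b" "b \<le> d" for a b d y :: real
    using that by (auto simp: indicator_def)
  \<comment> \<open>The block carries mass \<open>A (N * x) - A x\<close>, and \<open>1 / y\<close>
    is at least \<open>1 / (N * x)\<close> on it.\<close>
  have block: "Q x \<ge> Q (N * x) + c / 2" if x: "0 < x" "N * x \<le> e" for x :: real
  proof -
    have Nx: "x \<le> N * x" "0 < N * x" using N x by auto
    have "(\<integral>y. indicator {x<..N * x} y * P y \<partial>lborel) = (\<integral>y. indicator {0<..N * x} y * P y - indicator {0<..x} y * P y \<partial>lborel)"
      using indicator_Ioc_diff[of 0 x "N * x"] Nx x by (simp add: left_diff_distrib)
    also have "\<dots> = A (N * x) - A x"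
      unfolding A_def by (intro Bochner_Integration.integral_diff intP)
    also have "\<dots> \<ge> c * (N * x) - D * x"
    proof -
      have "0 \<le> \<gamma> * (N * x) * Q (N * x)"
        using Q0[of "N * x"] Nx pos x by (intro mult_nonneg_nonneg) auto
      then show ?thesis using A_ge[of "N * x"] A_le[of x] x Nx by linarith
    qed
    finally have 1: "c * (N * x) - D * x \<le> (\<integral>y. indicator {x<..N * x} y * P y \<partial>lborel)" .
    have "D \<le> c * N / 2" using N pos by (simp add: field_simps)
    then have "D * x \<le> c * N / 2 * x" using x by (intro mult_right_mono) auto
    with 1 have "c / 2 * (N * x) \<le> (\<integral>y. indicator {x<..N * x} y * P y \<partial>lborel)"
      by (simp add: field_simps)
    then have "c / 2 \<le> (\<integral>y. indicator {x<..N * x} y * P y \<partial>lborel) / (N * x)"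
      using Nx by (simp add: field_simps)
    also have "\<dots> = (\<integral>y. indicator {x<..N * x} y * P y / (N * x) \<partial>lborel)"
      by simp
    also have "\<dots> \<le> (\<integral>y. indicator {x<..N * x} y * (P y / y) \<partial>lborel)"
      using x P Nx by (intro integral_mono intQ integrable_divide intP)
         (auto simp: indicator_def intro!: divide_left_mono)
    also have "\<dots> = (\<integral>y. indicator {x<..e} y * (P y / y) - indicator {N * x<..e} y * (P y / y) \<partial>lborel)"
      using indicator_Ioc_diff'[of x "N * x" e] Nx x by (simp add: left_diff_distrib diff_divide_distrib)
    also have "\<dots> = Q x - Q (N * x)"
      unfolding Q_def using x Nx by (intro Bochner_Integration.integral_diff intQ) auto
    finally show ?thesis by simp
  qed
  have Qn: "Q (e / N ^ n) \<ge> n * (c / 2)" for n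
  proof (induction n)
    case 0
    then show ?case using Q0[OF pos(3)] by simp
  next
    case (Suc n)
    have eq: "N * (e / N ^ Suc n) = e / N ^ n" using N by simp
    have "e / N ^ n \<le> e / 1" using N pos by (intro divide_left_mono) auto
    then show ?case
      using block[of "e / N ^ Suc n"] Suc N pos unfolding eq by (simp add: algebra_simps)
  qed
  \<comment> \<open>Large enough that \<open>\<gamma> * (n * (c / 2))\<close> exceeds
    \<open>D\<close>.\<close>
  obtain n :: nat where n: "2 * D / (\<gamma> * c) < n" using reals_Archimedean2 by blast
  let ?x = "e / N ^ n"
  have x: "0 < ?x" "?x \<le> e"
    using N pos by (auto simp: field_simps intro!: self_le_power)
  have "\<gamma> * ?x * (n * (c / 2)) \<le> \<gamma> * ?x * Q ?x"
    using Qn x pos by (intro mult_left_mono) auto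
  also have "\<dots> \<le> D * ?x" using A_ge[OF x] A_le[OF x(1)] mult_pos_pos[OF pos(1) x(1)] by linarith
  finally have "?x * (\<gamma> * (n * (c / 2))) \<le> ?x * D" by (simp add: mult_ac)
  then have "\<gamma> * (n * (c / 2)) \<le> D" using x(1) by (simp only: mult_le_cancel_left_pos)
  with n pos show False by (simp add: field_simps)
qed

lemma Bernoulli_neg_powr:
  fixes y \<gamma> :: real
  assumes "0 \<le> y" "y < 1" "0 < \<gamma>"
  shows "1 + \<gamma> * y \<le> (1 - y) powr (- \<gamma>)"
proof -
  have "ln (1 - y) \<le> - y" using ln_le_minus_one[of "1 - y"] assms by simp
  then have "\<gamma> * y \<le> \<gamma> * - ln (1 - y)" using assms by (intro mult_left_mono) auto
  then have "1 + \<gamma> * y \<le> 1 + (- \<gamma> * ln (1 - y))" by simp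
  also have "\<dots> \<le> exp (- \<gamma> * ln (1 - y))" by (rule exp_ge_add_one_self)
  also have "\<dots> = (1 - y) powr (- \<gamma>)" using assms by (simp add: powr_def)
  finally show ?thesis .
qed

text \<open>Writing \<open>x - \<epsilon> = x * (1 - \<epsilon> / x)\<close> reduces this to the
  Bernoulli bound. It is the tangent estimate for the convex kernel, whose derivative is
  \<open>- \<gamma>\<close> times the kernel over \<open>x\<close>; the integral of
  \<open>P x / x\<close> originates here.\<close>

lemma rl_kernel_decrease:
  assumes "0 < \<gamma>" "\<gamma> < 1" "0 \<le> \<epsilon>" "\<epsilon> < x"
  shows "\<gamma> * \<epsilon> * (rl_kernel (1 - \<gamma>) x / x) \<le> rl_kernel (1 - \<gamma>) (x - \<epsilon>) - rl_kernel (1 - \<gamma>) x"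
proof -
  have G: "Gamma (1 - \<gamma>) > 0" using assms by (intro Gamma_real_pos) auto
  have "x - \<epsilon> = x * (1 - \<epsilon> / x)" using assms by (simp add: field_simps)
  then have "(x - \<epsilon>) powr (- \<gamma>) = x powr (- \<gamma>) * (1 - \<epsilon> / x) powr (- \<gamma>)"
    using assms by (simp add: powr_mult)
  also have "\<dots> \<ge> x powr (- \<gamma>) * (1 + \<gamma> * (\<epsilon> / x))"
    using assms by (intro mult_left_mono Bernoulli_neg_powr) auto
  finally have "x powr (- \<gamma>) * (1 + \<gamma> * (\<epsilon> / x)) / Gamma (1 - \<gamma>) \<le> (x - \<epsilon>) powr (- \<gamma>) / Gamma (1 - \<gamma>)"
    using G by (intro divide_right_mono) auto
  then show ?thesis using assms by (simp add: rl_kernel_def algebra_simps add_divide_distrib)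
qed

text \<open>A two-sided bound of \<open>H\<close> by \<open>W\<close> suffices: just before a first
  zero \<open>W\<close> is small, hence so is \<open>H\<close>, whereas the term with
  \<open>w0\<close> stays of order \<open>\<epsilon>\<close>.\<close>

lemma Volterra_positivity:
  assumes \<gamma>: "0 < \<gamma>" "\<gamma> < 1" and w0: "w0 > 0" and L: "0 \<le> L" and H: "causal H"
    and W: "\<And>t. W t = w0 + rl_int \<gamma> H t"
    and le: "AE t in lborel. 0 \<le> t \<and> t \<le> R \<longrightarrow> \<bar>H t\<bar> \<le> L * \<bar>W t\<bar>"
    and t: "0 \<le> t" "t \<le> R"
  shows "W t > 0"
proof (rule ccontr)
  assume "\<not> W t > 0"
  note [measurable] = causal_measurable[OF H]
  let ?V = "rl_int \<gamma> H"
  have V: "causal ?V" by (intro causal_rl_int \<gamma> H)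
  note [measurable] = causal_measurable[OF V]
  have W_eq: "W = (\<lambda>t. w0 + ?V t)" using W by blast
  have W_meas [measurable]: "W \<in> borel_measurable borel" unfolding W_eq by measurable
  have cont: "isCont W s" for s
    unfolding W_eq using \<gamma> by (intro continuous_intros isCont_rl_int H) auto
  \<comment> \<open>The set where \<open>W \<le> 0\<close> is closed, so its part in
    \<open>{0..t}\<close> has a least point.\<close>
  have "\<exists>ts\<in>{0..t} \<inter> {s. W s \<le> 0}. \<forall>y\<in>{0..t} \<inter> {s. W s \<le> 0}. ts \<le> y"
  proof (rule compact_attains_inf)
    have "closed {s. W s \<le> 0}"
      using cont by (intro closed_Collect_le continuous_at_imp_continuous_on) auto
    then show "compact ({0..t} \<inter> {s. W s \<le> 0})" by (intro compact_Int_closed) auto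
    show "{0..t} \<inter> {s. W s \<le> 0} \<noteq> {}" using \<open>\<not> W t > 0\<close> t by force
  qed
  then obtain ts where ts: "0 \<le> ts" "ts \<le> t" "W ts \<le> 0" and first: "\<And>y. \<lbrakk>0 \<le> y; y \<le> t; W y \<le> 0\<rbrakk> \<Longrightarrow> ts \<le> y"
    by auto
  have Wneg: "W s = w0" if "s \<le> 0" for s
    using that by (simp add: W rl_int_nonpos[OF H])
  then have ts0: "ts > 0" using ts w0 by (metis linorder_not_less order_antisym_conv)
  have Wpos: "W s > 0" if "s < ts" for s
    using first[of s] Wneg[of s] w0 that ts by (cases "s \<le> 0") force+
  have Wts: "W ts = 0"
  proof (rule ccontr)
    assume "W ts \<noteq> 0"
    then have "W ts < 0" using ts by simp
    then have "\<forall>\<^sub>F s in at ts. W s < 0"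
      by (rule order_tendstoD(2)[OF cont[unfolded isCont_def]])
    then have "\<forall>\<^sub>F s in at_left ts. W s < 0" by (rule filter_leD[OF at_le, rotated]) auto
    moreover have "\<forall>\<^sub>F s in at_left ts. s < ts" by (simp add: eventually_at_filter)
    ultimately have "\<forall>\<^sub>F s in at_left ts. False"
      by eventually_elim (use Wpos in force)
    then show False by simp
  qed
  obtain B where B: "\<forall>s\<le>R. \<bar>H s\<bar> \<le> B" using H unfolding causal_def by meson
  have B0: "B \<ge> 0" using B[rule_format, of R] by simp
  define C where "C = 2 * B / Gamma (\<gamma> + 1)"
  have Gp: "Gamma (\<gamma> + 1) > 0" "Gamma (1 - \<gamma>) > 0" using \<gamma> by (auto intro!: Gamma_real_pos)
  have C0: "C \<ge> 0" using B0 Gp by (simp add: C_def)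
  \<comment> \<open>With \<open>W ts = 0\<close>, Hoelder continuity becomes a decay rate at
    \<open>ts\<close>, of just the order that cancels the singularity
    \<open>x powr (- \<gamma>)\<close> of the kernel; hence \<open>P\<close> below is
    bounded.\<close>
  have Whold: "W (ts - x) \<le> C * x powr \<gamma>" if "x > 0" for x
  proof -
    have "\<bar>?V ts - ?V (ts - x)\<bar> \<le> 2 * B * rl_kernel (\<gamma> + 1) (ts - (ts - x))"
      using B ts t that \<gamma> by (intro rl_int_holder H B0 AE_I2) auto
    then have "\<bar>W ts - W (ts - x)\<bar> \<le> C * x powr \<gamma>"
      using that by (simp add: W rl_kernel_def C_def)
    then show ?thesis using Wts by simp
  qed
  let ?K = "rl_kernel (1 - \<gamma>)"
  have Kx: "?K x * x powr \<gamma> = 1 / Gamma (1 - \<gamma>)" if "x > 0" for x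
    using that by (simp add: rl_kernel_def powr_add[symmetric])
  have K0: "?K x \<ge> 0" for x using \<gamma> by (intro rl_kernel_nonneg) auto
  define P where "P x = indicator {0<..<ts} x * (?K x * W (ts - x))" for x
  \<comment> \<open>The term with \<open>w0\<close> will yield at least
    \<open>w0 * ?K ts * \<epsilon>\<close>; half of it pays for \<open>H\<close>, the other half is
    the \<open>c * \<epsilon>\<close> required by \<open>log_divergence\<close>.\<close>
  define c where "c = w0 * ?K ts / 2"
  have "?K ts > 0" using ts0 Gp by (simp add: rl_kernel_def)
  then have c0: "c > 0" using w0 by (simp add: c_def)
  \<comment> \<open>Small enough that \<open>L * C * e powr \<gamma> \<le> c\<close>, which controls
    the contribution of \<open>H\<close>. The \<open>+ 1\<close> avoids a zero denominator, and
    \<open>ts / 2\<close> keeps all lags up to \<open>e\<close> below \<open>ts\<close>.\<close>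
  define e where "e = min (ts / 2) ((c / (L * C + 1)) powr (1 / \<gamma>))"
  have LC: "L * C \<ge> 0" using L C0 by simp
  then have e: "0 < e" "e < ts" using ts0 c0 by (auto simp: e_def)
  have "L * C * e powr \<gamma> \<le> L * C * ((c / (L * C + 1)) powr (1 / \<gamma>)) powr \<gamma>"
    using e LC \<gamma> by (intro mult_left_mono powr_mono2) (auto simp: e_def)
  also have "\<dots> = L * C * c / (L * C + 1)"
    using \<gamma> c0 LC by (simp add: powr_powr)
  also have "\<dots> \<le> c" using c0 LC by (simp add: field_simps)
  finally have e_small: "L * C * e powr \<gamma> \<le> c" .
  have Pmeas [measurable]: "P \<in> borel_measurable borel" unfolding P_def by measurable
  have P_nonneg: "P x \<ge> 0" for x
    using Wpos[of "ts - x"] K0[of x] by (auto simp: P_def indicator_def)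
  have P_le: "P x \<le> C / Gamma (1 - \<gamma>)" for x
  proof (cases "0 < x \<and> x < ts")
    case True
    have "?K x * W (ts - x) \<le> ?K x * (C * x powr \<gamma>)"
      using Whold[of x] K0[of x] True by (intro mult_left_mono) auto
    also have "\<dots> = C / Gamma (1 - \<gamma>)" using Kx[of x] True by (simp add: mult.left_commute[of _ C])
    finally show ?thesis using True by (simp add: P_def)
  qed (use C0 Gp in \<open>auto simp: P_def\<close>)
  have Pbd: "integrable lborel (\<lambda>x. indicator {a<..b} x * P x)" for a b
  proof (rule Bochner_Integration.integrable_bound)
    show "integrable lborel (\<lambda>x. C / Gamma (1 - \<gamma>) * indicator {a..b} x)"
      by (intro integrable_mult_right integrable_real_indicator) (auto simp: emeasure_lborel_Icc_eq)
    show "AE x in lborel. norm (indicator {a<..b} x * P x) \<le> norm (C / Gamma (1 - \<gamma>) * indicator {a..b} x)"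
      using P_nonneg P_le C0 Gp by (auto simp: indicator_def intro!: AE_I2)
  qed auto
  show False
  proof (rule log_divergence[of P "C / Gamma (1 - \<gamma>)" c \<gamma> e])
    fix \<epsilon> assume \<epsilon>: "0 < \<epsilon>" "\<epsilon> \<le> e"
    let ?J = "rl_int (1 - \<gamma>) ?V"
    have J1: "?J s = rl_int 1 H s" for s using rl_int_semigroup[of "1 - \<gamma>" \<gamma> H s] \<gamma> H by simp
    \<comment> \<open>During the last \<open>\<epsilon>\<close> before \<open>ts\<close>,
      \<open>\<bar>H\<bar>\<close> is at most \<open>L * C * \<epsilon> powr \<gamma>\<close> almost
      everywhere, so the primitive of \<open>H\<close> drops by at most that times
      \<open>\<epsilon>\<close>.\<close>
    have "rl_int 1 H ts - rl_int 1 H (ts - \<epsilon>) = (\<integral>s. indicator {..<ts} s * H s - indicator {..<ts - \<epsilon>} s * H s \<partial>lborel)"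
      by (simp add: rl_int_1 Bochner_Integration.integral_diff[OF causal_integrable[OF H] causal_integrable[OF H]])
    also have "\<dots> \<ge> (\<integral>s. - (L * C * \<epsilon> powr \<gamma>) * indicator {ts - \<epsilon>..ts} s \<partial>lborel)"
    proof (rule integral_mono_AE)
      show "integrable lborel (\<lambda>s. - (L * C * \<epsilon> powr \<gamma>) * indicator {ts - \<epsilon>..ts} s)"
        by (intro integrable_mult_right integrable_real_indicator) (auto simp: emeasure_lborel_Icc_eq)
      show "integrable lborel (\<lambda>s. indicator {..<ts} s * H s - indicator {..<ts - \<epsilon>} s * H s)"
        by (intro Bochner_Integration.integrable_diff causal_integrable H)
      show "AE s in lborel. - (L * C * \<epsilon> powr \<gamma>) * indicator {ts - \<epsilon>..ts} s \<le> indicator {..<ts} s * H s - indicator {..<ts - \<epsilon>} s * H s"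
        using le
      proof eventually_elim
        case (elim s)
        show ?case
        proof (cases "ts - \<epsilon> \<le> s \<and> s < ts")
          case True
          then have "\<bar>H s\<bar> \<le> L * W s" using elim \<epsilon> e ts t Wpos[of s] by auto
          also have "\<dots> \<le> L * (C * (ts - s) powr \<gamma>)" using Whold[of "ts - s"] True L by (intro mult_left_mono) auto
          also have "\<dots> \<le> L * (C * \<epsilon> powr \<gamma>)"
            using True \<gamma> L C0 by (intro mult_left_mono powr_mono2) auto
          finally show ?thesis using True by simp
        next
          case False
          then show ?thesis using LC \<epsilon> by (auto simp: indicator_def)
        qed
      qed
    qed
    also have "(\<integral>s. - (L * C * \<epsilon> powr \<gamma>) * indicator {ts - \<epsilon>..ts} s \<partial>lborel) = - (L * C * \<epsilon> powr \<gamma>) * \<epsilon>"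
      using \<epsilon> by simp
    finally have lower: "- (L * C * \<epsilon> powr \<gamma>) * \<epsilon> \<le> ?J ts - ?J (ts - \<epsilon>)" by (simp add: J1)
    \<comment> \<open>At negative times \<open>?V\<close> is zero although \<open>W = w0\<close>.
      The cutoff at lag \<open>ts\<close> accounts for this and splits each integral into a part
      with \<open>W\<close> and \<open>w0\<close> times a kernel mass.\<close>
    have Veq: "k * ?V (ts - x) = k * indicator {..<ts} x * W (ts - x) - w0 * (k * indicator {..<ts} x)" for k x :: real
      using causal_neg[OF V, of "ts - x"] rl_int_nonpos[OF H, of "ts - x" \<gamma>]
      by (auto simp: W indicator_def algebra_simps)
    have i1: "integrable lborel (\<lambda>x. ?K x * indicator {..<ts} x * W (ts - x))"
    proof -
      have "integrable lborel (\<lambda>x. ?K x * ?V (ts - x) + w0 * (?K x * indicator {..<ts} x))"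
        using rl_kernel_indicator[of "1 - \<gamma>" ts] \<gamma>
        by (intro Bochner_Integration.integrable_add integrable_mult_right rl_int_integrable V)
           (auto simp: has_bochner_integral_iff)
      then show ?thesis by (simp add: Veq)
    qed
    have i2: "integrable lborel (\<lambda>x. ?K (x - \<epsilon>) * indicator {..<ts} x * W (ts - x))"
    proof -
      have "integrable lborel (\<lambda>x. ?K (x - \<epsilon>) * ?V (ts - x))"
        using lborel_integrable_real_affine_iff[of 1 "\<lambda>x. ?K x * ?V (ts - \<epsilon> - x)" "-\<epsilon>"]
          rl_int_integrable[OF _ V, of "1 - \<gamma>" "ts - \<epsilon>"] \<gamma> by simp
      then have "integrable lborel (\<lambda>x. ?K (x - \<epsilon>) * ?V (ts - x) + w0 * (?K (x - \<epsilon>) * indicator {..<ts} x))"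
        using rl_kernel_shift_indicator[of "1 - \<gamma>" \<epsilon> ts] \<gamma>
        by (intro Bochner_Integration.integrable_add integrable_mult_right)
           (auto simp: has_bochner_integral_iff)
      then show ?thesis by (simp add: Veq)
    qed
    let ?G = "rl_kernel (1 - \<gamma> + 1)"
    have kern1: "has_bochner_integral lborel (\<lambda>x. ?K x * indicator {..<s} x) (?G s)" for s
      using \<gamma> by (intro rl_kernel_indicator) auto
    have kern2: "has_bochner_integral lborel (\<lambda>x. ?K (x - \<epsilon>) * indicator {..<ts} x) (?G (ts - \<epsilon>))"
      using \<gamma> by (intro rl_kernel_shift_indicator) auto
    have "?J ts = (\<integral>x. ?K x * indicator {..<ts} x * W (ts - x) \<partial>lborel) - w0 * ?G ts"
      unfolding rl_int_def[of "1 - \<gamma>"] Veq using kern1[of ts]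
      by (subst Bochner_Integration.integral_diff) (auto simp: has_bochner_integral_iff i1)
    moreover have "?J (ts - \<epsilon>) = (\<integral>x. ?K (x - \<epsilon>) * indicator {..<ts} x * W (ts - x) \<partial>lborel) - w0 * ?G (ts - \<epsilon>)"
      unfolding rl_int_shift[of "1 - \<gamma>" ?V] Veq using kern2
      by (subst Bochner_Integration.integral_diff) (auto simp: has_bochner_integral_iff i2)
    ultimately have Jdiff: "?J ts - ?J (ts - \<epsilon>) = (\<integral>x. ?K x * indicator {..<ts} x * W (ts - x) - ?K (x - \<epsilon>) * indicator {..<ts} x * W (ts - x) \<partial>lborel)
       - w0 * (?G ts - ?G (ts - \<epsilon>))"
      unfolding Bochner_Integration.integral_diff[OF i1 i2] by (simp add: algebra_simps)
    have iQ: "integrable lborel (\<lambda>x. indicator {\<epsilon><..e} x * (P x / x))"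
    proof (rule Bochner_Integration.integrable_bound)
      show "integrable lborel (\<lambda>x. 1 / \<epsilon> * (indicator {\<epsilon><..e} x * P x))"
        by (intro integrable_mult_right Pbd)
      show "AE x in lborel. norm (indicator {\<epsilon><..e} x * (P x / x)) \<le> norm (1 / \<epsilon> * (indicator {\<epsilon><..e} x * P x))"
        using P_nonneg \<epsilon> by (intro AE_I2) (auto simp: indicator_def intro!: divide_left_mono)
    qed auto
    \<comment> \<open>Up to lag \<open>\<epsilon>\<close> only the unshifted kernel is present and
      gives \<open>P\<close>. Between \<open>\<epsilon>\<close> and \<open>e\<close> the shifted
      kernel is larger by at least \<open>\<gamma> * \<epsilon> * (?K x / x)\<close>. Beyond
      \<open>e\<close> the difference is not positive and is discarded.\<close>
    have "(\<integral>x. ?K x * indicator {..<ts} x * W (ts - x) - ?K (x - \<epsilon>) * indicator {..<ts} x * W (ts - x) \<partial>lborel)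
       \<le> (\<integral>x. indicator {0<..\<epsilon>} x * P x - \<gamma> * \<epsilon> * (indicator {\<epsilon><..e} x * (P x / x)) \<partial>lborel)"
    proof (rule integral_mono)
      fix x
      have Wx: "W (ts - x) \<ge> 0" if "x > 0" using Wpos[of "ts - x"] that by simp
      consider "x \<le> 0" | "x \<ge> ts" | "0 < x" "x \<le> \<epsilon>" "x < ts" | "\<epsilon> < x" "x < ts"
        by linarith
      then show "?K x * indicator {..<ts} x * W (ts - x) - ?K (x - \<epsilon>) * indicator {..<ts} x * W (ts - x)
        \<le> indicator {0<..\<epsilon>} x * P x - \<gamma> * \<epsilon> * (indicator {\<epsilon><..e} x * (P x / x))"
      proof cases
        case 1
        then show ?thesis using \<epsilon> by (simp add: rl_kernel_def P_def)
      next
        case 2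
        then show ?thesis using \<epsilon> e by (simp add: P_def)
      next
        case 3
        then have "?K (x - \<epsilon>) = 0" by (simp add: rl_kernel_def)
        then show ?thesis using 3 by (simp add: P_def)
      next
        case 4
        have "\<gamma> * \<epsilon> * (?K x / x) * W (ts - x) \<le> (?K (x - \<epsilon>) - ?K x) * W (ts - x)"
          using 4 \<epsilon> Wx \<gamma> by (intro mult_right_mono rl_kernel_decrease) auto
        moreover have "0 \<le> \<gamma> * \<epsilon> * (?K x / x) * W (ts - x)"
          using 4 \<epsilon> \<gamma> K0[of x] Wx by auto
        ultimately show ?thesis using 4 \<epsilon>
          by (cases "x \<le> e") (auto simp: P_def algebra_simps)
      qed
    qed (intro Bochner_Integration.integrable_diff integrable_mult_right i1 i2 Pbd iQ)+
    also have "\<dots> = (\<integral>x. indicator {0<..\<epsilon>} x * P x \<partial>lborel) - \<gamma> * \<epsilon> * (\<integral>x. indicator {\<epsilon><..e} x * (P x / x) \<partial>lborel)"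
      unfolding integral_mult_right_zero[symmetric]
      by (intro Bochner_Integration.integral_diff Pbd integrable_mult_right iQ)
    finally have upper: "?J ts - ?J (ts - \<epsilon>) \<le> (\<integral>x. indicator {0<..\<epsilon>} x * P x \<partial>lborel)
      - \<gamma> * \<epsilon> * (\<integral>x. indicator {\<epsilon><..e} x * (P x / x) \<partial>lborel) - w0 * (?G ts - ?G (ts - \<epsilon>))"
      using Jdiff by simp
    \<comment> \<open>The difference is the mass of \<open>?K\<close> between
      \<open>ts - \<epsilon>\<close> and \<open>ts\<close>, where the decreasing kernel is at least
      \<open>?K ts\<close>.\<close>
    have "?G ts - ?G (ts - \<epsilon>) = (\<integral>x. ?K x * indicator {..<ts} x - ?K x * indicator {..<ts - \<epsilon>} x \<partial>lborel)"
      using kern1[of ts] kern1[of "ts - \<epsilon>"] by (subst Bochner_Integration.integral_diff) (auto simp: has_bochner_integral_iff)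
    also have "\<dots> \<ge> (\<integral>x. ?K ts * indicator {ts - \<epsilon>..<ts} x \<partial>lborel)"
    proof (rule integral_mono)
      show "integrable lborel (\<lambda>x. ?K ts * indicator {ts - \<epsilon>..<ts} x)"
        by (intro integrable_mult_right integrable_real_indicator) (use \<epsilon> in auto)
      show "integrable lborel (\<lambda>x. ?K x * indicator {..<ts} x - ?K x * indicator {..<ts - \<epsilon>} x)"
        using kern1 by (intro Bochner_Integration.integrable_diff) (auto simp: has_bochner_integral_iff)
      fix x
      show "?K ts * indicator {ts - \<epsilon>..<ts} x \<le> ?K x * indicator {..<ts} x - ?K x * indicator {..<ts - \<epsilon>} x"
      proof (cases "ts - \<epsilon> \<le> x \<and> x < ts")
        case True
        then have "?K ts \<le> ?K x" using \<epsilon> e \<gamma> by (intro rl_kernel_antimono) auto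
        then show ?thesis using True by simp
      next
        case False
        then show ?thesis using \<epsilon> by (auto simp: indicator_def)
      qed
    qed
    finally have "?G ts - ?G (ts - \<epsilon>) \<ge> ?K ts * \<epsilon>" using \<epsilon> by simp
    then have "w0 * (?K ts * \<epsilon>) \<le> w0 * (?G ts - ?G (ts - \<epsilon>))" using w0 by (intro mult_left_mono) auto
    then have mass: "2 * (c * \<epsilon>) \<le> w0 * (?G ts - ?G (ts - \<epsilon>))" by (simp add: c_def)
    have "L * C * \<epsilon> powr \<gamma> \<le> L * C * e powr \<gamma>" using \<epsilon> \<gamma> LC by (intro mult_left_mono powr_mono2) auto
    then have "L * C * \<epsilon> powr \<gamma> * \<epsilon> \<le> c * \<epsilon>" using e_small \<epsilon> by (intro mult_right_mono) auto
    then have "- (c * \<epsilon>) \<le> ?J ts - ?J (ts - \<epsilon>)" using lower by simp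
    with upper have "- (c * \<epsilon>) \<le> (\<integral>x. indicator {0<..\<epsilon>} x * P x \<partial>lborel)
      - \<gamma> * \<epsilon> * (\<integral>x. indicator {\<epsilon><..e} x * (P x / x) \<partial>lborel) - w0 * (?G ts - ?G (ts - \<epsilon>))"
      by (rule order_trans[rotated])
    with mass show "c * \<epsilon> + \<gamma> * \<epsilon> * (\<integral>x. indicator {\<epsilon><..e} x * (P x / x) \<partial>lborel) \<le> (\<integral>x. indicator {0<..\<epsilon>} x * P x \<partial>lborel)"
      by linarith
  qed (use P_nonneg P_le c0 \<gamma> e in auto)
qed

section \<open>From distributions to the Volterra equation\<close>

text \<open>A class closed under differentiation contains all iterated derivatives of its members,
  so smoothness reduces to exhibiting such a class.\<close>

lemma smooth_coinduct:
  fixes f :: "real \<Rightarrow> real"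
  assumes "f \<in> X" "\<And>g. g \<in> X \<Longrightarrow> \<exists>g'\<in>X. \<forall>x. (g has_field_derivative g' x) (at x)"
  shows "(deriv ^^ n) f field_differentiable (at x)"
proof -
  have "(deriv ^^ n) f \<in> X"
  proof (induction n)
    case (Suc n)
    then obtain g' where "g' \<in> X" "\<forall>x. ((deriv ^^ n) f has_field_derivative g' x) (at x)"
      using assms(2) by blast
    moreover from this have "deriv ((deriv ^^ n) f) = g'" by (auto intro: DERIV_imp_deriv)
    ultimately show ?case by simp
  qed (use assms in simp)
  then show ?thesis using assms(2) by (meson field_differentiable_def)
qed

text \<open>
  The factor \<open>exp (-1 / z)\<close> is kept together with a power of \<open>1 / z\<close> so that the functions
  \<open>poly p x * flat_exp k (1 - x\<^sup>2)\<close> are closed under differentiation.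
\<close>

definition flat_exp :: "nat \<Rightarrow> real \<Rightarrow> real" where
  "flat_exp k z = (if z > 0 then (1 / z) ^ k * exp (- (1 / z)) else 0)"

lemma flat_exp_Suc: "z * flat_exp (Suc k) z = flat_exp k z"
  by (simp add: flat_exp_def)

lemma flat_exp_tendsto_0: "(flat_exp k \<longlongrightarrow> 0) (at 0)"
proof -
  have "((\<lambda>z. inverse z ^ k / exp (inverse z)) \<longlongrightarrow> 0) (at_right (0::real))"
    by (rule filterlim_compose[OF tendsto_power_div_exp_0 filterlim_inverse_at_top_right])
  then have "(flat_exp k \<longlongrightarrow> 0) (at_right 0)"
    by (rule Lim_transform_eventually)
       (auto simp: eventually_at_filter flat_exp_def exp_minus field_simps)
  moreover have "(flat_exp k \<longlongrightarrow> 0) (at_left 0)"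
    by (rule Lim_transform_eventually[of "\<lambda>_. 0"])
       (auto simp: eventually_at_filter flat_exp_def)
  ultimately show ?thesis by (simp add: filterlim_split_at)
qed

lemma flat_exp_has_derivative:
  "(flat_exp k has_field_derivative flat_exp (k + 2) z - k * flat_exp (k + 1) z) (at z)"
proof -
  consider "z < 0" | "z = 0" | "z > 0" by linarith
  then show ?thesis
  proof cases
    case 1
    have "((\<lambda>_. 0) has_field_derivative flat_exp (k + 2) z - k * flat_exp (k + 1) z) (at z)"
      using 1 by (simp add: flat_exp_def)
    then show ?thesis
      by (rule has_field_derivative_transform_within_open[of _ _ _ "{..<0}"]) (use 1 in \<open>auto simp: flat_exp_def\<close>)
  next
    case 2
    \<comment> \<open>The difference quotient of \<open>flat_exp k\<close> at \<open>0\<close> is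
      itself \<open>flat_exp (Suc k) h\<close>.\<close>
    have "((\<lambda>h. flat_exp (Suc k) h) \<longlongrightarrow> 0) (at 0)" by (rule flat_exp_tendsto_0)
    then have "((\<lambda>h. (flat_exp k (0 + h) - flat_exp k 0) / h) \<longlongrightarrow> 0) (at 0)"
      by (rule Lim_transform_eventually)
         (auto simp: eventually_at_filter flat_exp_def)
    then show ?thesis using 2 by (simp add: DERIV_def flat_exp_def)
  next
    case 3
    have "((\<lambda>z. (1 / z) ^ k * exp (- (1 / z))) has_field_derivative flat_exp (k + 2) z - k * flat_exp (k + 1) z) (at z)"
      using 3 by (auto intro!: derivative_eq_intros simp: flat_exp_def power2_eq_square field_simps)
        (cases k; simp add: field_simps)
    then show ?thesis
      by (rule has_field_derivative_transform_within_open[of _ _ _ "{0<..}"]) (use 3 in \<open>auto simp: flat_exp_def\<close>)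
  qed
qed

text \<open>The terms of the derivative carry the indices \<open>k\<close>, \<open>k + 1\<close> and
  \<open>k + 2\<close>; factors \<open>1 - x\<^sup>2\<close>, the polynomial
  \<open>[:1, 0, -1:]\<close>, bring all of them to \<open>k + 2\<close>.\<close>

lemma bump_has_derivative:
  fixes p :: "real poly"
  shows "((\<lambda>x. poly p x * flat_exp k (1 - x\<^sup>2)) has_field_derivative
    poly (pderiv p * [:1, 0, -1:]\<^sup>2 + smult (2 * k) (p * [:0, 1:] * [:1, 0, -1:]) - smult 2 ([:0, 1:] * p)) x
      * flat_exp (k + 2) (1 - x\<^sup>2)) (at x)"
proof -
  let ?z = "1 - x\<^sup>2"
  have 1: "flat_exp (k + 1) ?z = ?z * flat_exp (k + 2) ?z" using flat_exp_Suc[of ?z "k + 1"] by simp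
  have 2: "flat_exp k ?z = ?z * (?z * flat_exp (k + 2) ?z)" using flat_exp_Suc[of ?z k] 1 by simp
  have p: "poly [:1, 0, -1:] x = ?z" by (simp add: power2_eq_square)
  show ?thesis
    by (rule derivative_eq_intros poly_DERIV DERIV_chain'[OF _ flat_exp_has_derivative] refl)+
       (simp only: 1 2 p poly_add poly_diff poly_mult poly_smult poly_power, simp add: algebra_simps power2_eq_square)
qed

text \<open>\<open>S\<close> is the normalised primitive of the bump
  \<open>exp (- 1 / (1 - x\<^sup>2))\<close>. Both are used below: \<open>S\<close> builds the test
  functions, and its derivative \<open>\<rho>\<close> acts as a mollifier.\<close>

lemma smooth_step_exists:
  obtains S \<rho> :: "real \<Rightarrow> real"
  where "\<And>x. (S has_field_derivative \<rho> x) (at x)" "\<And>n x. (deriv ^^ n) S field_differentiable (at x)"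
    "\<And>x. x \<le> -1 \<Longrightarrow> S x = 0" "\<And>x. 1 \<le> x \<Longrightarrow> S x = 1" "\<And>x. 0 \<le> S x" "\<And>x. S x \<le> 1"
    "\<And>x. \<rho> x \<ge> 0" "\<And>x. \<bar>x\<bar> \<ge> 1 \<Longrightarrow> \<rho> x = 0" "\<And>x. isCont \<rho> x"
    "has_bochner_integral lborel \<rho> 1"
proof -
  let ?b = "\<lambda>x::real. flat_exp 0 (1 - x\<^sup>2)"
  have b: "?b x \<ge> 0" "\<bar>x\<bar> \<ge> 1 \<Longrightarrow> ?b x = 0" for x
    using abs_le_square_iff[of 1 x] by (auto simp: flat_exp_def)
  have bcont: "isCont ?b x" for x
    using bump_has_derivative[of 1 0 x] by (intro DERIV_isCont) auto
  obtain F where F: "\<And>x. (F has_field_derivative ?b x) (at x)"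
    using einterval_antiderivative[of "-\<infinity>" \<infinity> ?b] bcont by (auto simp: has_real_derivative_iff_has_vector_derivative)
  have mono: "F x \<le> F y" if "x \<le> y" for x y
    using F b that by (intro DERIV_nonneg_imp_nondecreasing[of x y F]) auto
  \<comment> \<open>Outside \<open>{-1<..<1}\<close> the derivative is zero, so \<open>F\<close> is
    nonincreasing there as well as nondecreasing.\<close>
  have flat: "\<exists>y. (F has_field_derivative y) (at x) \<and> y \<le> 0" if "\<bar>x\<bar> \<ge> 1" for x
    using F[of x] b(2)[OF that] by (intro exI[of _ "?b x"]) simp
  have Fl: "F x = F (-1)" if "x \<le> -1" for x
  proof (rule antisym)
    show "F (-1) \<le> F x"
      by (rule DERIV_nonpos_imp_nonincreasing[OF that]) (rule flat, simp)
  qed (use mono that in auto)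
  have Fr: "F x = F 1" if "1 \<le> x" for x
  proof (rule antisym)
    show "F x \<le> F 1"
      by (rule DERIV_nonpos_imp_nonincreasing[OF that]) (rule flat, simp)
  qed (use mono that in auto)
  have strict: "F (-1) < F 1"
  proof (rule DERIV_pos_imp_increasing_open[of "-1" 1 F])
    fix x :: real assume "-1 < x" "x < 1"
    then have "?b x > 0" by (auto simp: flat_exp_def abs_square_less_1)
    then show "\<exists>y. (F has_field_derivative y) (at x) \<and> y > 0" using F by blast
  qed (use F in \<open>auto intro!: continuous_at_imp_continuous_on DERIV_isCont\<close>)
  define d where "d = F 1 - F (-1)"
  have d: "d > 0" using strict by (simp add: d_def)
  define S where "S x = (F x - F (-1)) / d" for x
  define \<rho> where "\<rho> x = ?b x / d" for x
  have S': "(S has_field_derivative \<rho> x) (at x)" for x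
    unfolding S_def[abs_def] \<rho>_def by (rule derivative_eq_intros F refl)+ (use d in auto)
    \<comment> \<open>The derivative \<open>\<rho>\<close> of \<open>S\<close> is a polynomial times
      a \<open>flat_exp\<close> term, so adding \<open>S\<close> to that class keeps it closed under
      differentiation.\<close>
    have smooth: "(deriv ^^ n) S field_differentiable (at x)" for n x
    proof (rule smooth_coinduct[where X = "insert S {g. \<exists>p k. g = (\<lambda>x. poly p x * flat_exp k (1 - x\<^sup>2))}"])
      fix g assume "g \<in> insert S {g. \<exists>p k. g = (\<lambda>x. poly p x * flat_exp k (1 - x\<^sup>2))}"
      then consider "g = S" | p k where "g = (\<lambda>x. poly p x * flat_exp k (1 - x\<^sup>2))" by blast
      then show "\<exists>g'\<in>insert S {g. \<exists>p k. g = (\<lambda>x. poly p x * flat_exp k (1 - x\<^sup>2))}. \<forall>x. (g has_real_derivative g' x) (at x)"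
      proof cases
        case 1
        have "\<rho> = (\<lambda>x. poly [:1 / d:] x * flat_exp 0 (1 - x\<^sup>2))" by (auto simp: \<rho>_def)
        then have "\<rho> \<in> insert S {g. \<exists>p k. g = (\<lambda>x. poly p x * flat_exp k (1 - x\<^sup>2))}"
          by (intro insertI2 CollectI exI[of _ "[:1 / d:]"] exI[of _ 0])
        then show ?thesis using 1 S' by (intro bexI[of _ \<rho>]) auto
      next
        case 2
        obtain q where q: "\<And>x. (g has_field_derivative poly q x * flat_exp (k + 2) (1 - x\<^sup>2)) (at x)"
          using bump_has_derivative[of p k] unfolding 2 by blast
        show ?thesis
        proof (rule bexI)
          show "(\<lambda>x. poly q x * flat_exp (k + 2) (1 - x\<^sup>2)) \<in> insert S {g. \<exists>p k. g = (\<lambda>x. poly p x * flat_exp k (1 - x\<^sup>2))}"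
            by (intro insertI2 CollectI exI[of _ q] exI[of _ "k + 2"] refl)
        qed (use q in blast)
      qed
    qed simp
    have int1: "has_bochner_integral lborel \<rho> 1"
    proof -
      have "has_bochner_integral lborel (\<lambda>x. \<rho> x * indicator {-1..1} x) (S 1 - S (-1))"
        using S' bcont d by (intro has_bochner_integral_FTC_Icc_real) (auto simp: \<rho>_def[abs_def] intro!: continuous_intros)
      moreover have "(\<lambda>x. \<rho> x * indicator {-1..1} x) = \<rho>"
      proof
        fix x
        show "\<rho> x * indicator {-1..1} x = \<rho> x"
          by (cases "\<bar>x\<bar> \<ge> 1") (auto simp: \<rho>_def b(2) indicator_def abs_le_iff not_le)
      qed
      moreover have "S 1 - S (-1) = 1" using d by (simp add: S_def d_def)
      ultimately show ?thesis by simp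
    qed
    have S01: "0 \<le> S x \<and> S x \<le> 1" for x
    proof -
      have 1: "F (-1) \<le> F x"
      proof (cases "x \<le> -1")
        case True then show ?thesis using Fl by (metis order_refl)
      next
        case False then show ?thesis by (intro mono) simp
      qed
      have 2: "F x \<le> F 1"
      proof (cases "1 \<le> x")
        case True then show ?thesis using Fr by (metis order_refl)
      next
        case False then show ?thesis by (intro mono) simp
      qed
      have "F x - F (-1) \<le> d" using 2 unfolding d_def by linarith
      then show ?thesis unfolding S_def using d 1 by (intro conjI divide_nonneg_pos) auto
    qed
    have "0 \<le> S x" "S x \<le> 1" for x using S01 by auto
    moreover have "S x = 0" if "x \<le> -1" for x using Fl[OF that] by (simp add: S_def)
    moreover have "S x = 1" if "1 \<le> x" for x using Fr[OF that] d by (simp add: S_def d_def)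
    moreover have "isCont \<rho> x" for x
      unfolding \<rho>_def[abs_def] using d bcont by (intro continuous_intros) auto
    moreover have "\<rho> x \<ge> 0" for x using b(1)[of x] d by (simp add: \<rho>_def)
    moreover have "\<rho> x = 0" if "\<bar>x\<bar> \<ge> 1" for x using b(2)[OF that] by (simp add: \<rho>_def)
    ultimately show ?thesis using S' smooth int1 that by blast
qed

text \<open>
  Only \<open>S ((t - a) / \<epsilon>)\<close> matters below: the summand \<open>S (t + 3)\<close> is constant for \<open>t \<ge> 0\<close> and merely
  makes the support compact.
\<close>

lemma test_fun_cutoff:
  fixes S :: "real \<Rightarrow> real"
  assumes S: "\<And>n x. (deriv ^^ n) S field_differentiable (at x)" "\<And>x. x \<le> -1 \<Longrightarrow> S x = 0" "\<And>x. 1 \<le> x \<Longrightarrow> S x = 1"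
    and a: "0 \<le> a" "0 < \<epsilon>" "\<epsilon> \<le> 1" "ereal (a + \<epsilon>) < T"
  shows "test_fun T (\<lambda>t. S (t + 3) - S ((t - a) / \<epsilon>))"
proof -
  let ?\<phi> = "\<lambda>t. S (t + 3) - S ((t - a) / \<epsilon>)"
  \<comment> \<open>Each derivative combines one and the same derivative of \<open>S\<close> at two
    affine arguments; differentiating divides the second coefficient by
    \<open>\<epsilon>\<close>.\<close>
  let ?X = "{g. \<exists>k1 k2 m. g = (\<lambda>t. k1 * (deriv ^^ m) S (t + 3) + k2 * (deriv ^^ m) S ((t - a) / \<epsilon>))}"
  have "(deriv ^^ n) ?\<phi> field_differentiable (at x)" for n x
  proof (rule smooth_coinduct[where X = ?X])
    show "?\<phi> \<in> ?X" by (rule CollectI, rule exI[of _ 1], rule exI[of _ "-1"], rule exI[of _ 0]) simp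
    fix g assume "g \<in> ?X"
    then obtain k1 k2 m where g: "g = (\<lambda>t. k1 * (deriv ^^ m) S (t + 3) + k2 * (deriv ^^ m) S ((t - a) / \<epsilon>))" by blast
    have D: "((deriv ^^ m) S has_field_derivative (deriv ^^ Suc m) S y) (at y)" for y
      using S(1)[of m y] by (simp add: field_differentiable_derivI)
    have "(g has_field_derivative k1 * (deriv ^^ Suc m) S (t + 3) + (k2 / \<epsilon>) * (deriv ^^ Suc m) S ((t - a) / \<epsilon>)) (at t)" for t
      unfolding g using a(2)
      by (auto intro!: derivative_eq_intros DERIV_chain'[OF _ D] simp del: funpow.simps)
    then show "\<exists>g'\<in>?X. \<forall>x. (g has_field_derivative g' x) (at x)"
      by (intro bexI[of _ "\<lambda>t. k1 * (deriv ^^ Suc m) S (t + 3) + (k2 / \<epsilon>) * (deriv ^^ Suc m) S ((t - a) / \<epsilon>)"]) blast+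
  qed
  \<comment> \<open>Left of \<open>-4\<close> both summands are \<open>0\<close>; right of
    \<open>a + \<epsilon>\<close> both are \<open>1\<close> and cancel.\<close>
  moreover have "{x. ?\<phi> x \<noteq> 0} \<subseteq> {-4..a + \<epsilon>}"
  proof safe
    fix x assume nz: "?\<phi> x \<noteq> 0"
    have "S (x + 3) = 0 \<and> S ((x - a) / \<epsilon>) = 0" if "x < -4"
      using that a by (intro conjI S(2)) (auto simp: field_simps)
    moreover have "S (x + 3) = 1 \<and> S ((x - a) / \<epsilon>) = 1" if "x > a + \<epsilon>"
      using that a by (intro conjI S(3)) (auto simp: field_simps)
    ultimately show "x \<in> {-4..a + \<epsilon>}" using nz by fastforce
  qed
  then have "closure {x. ?\<phi> x \<noteq> 0} \<subseteq> {-4..a + \<epsilon>}" by (intro closure_minimal) auto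
  moreover from this have "compact (closure {x. ?\<phi> x \<noteq> 0})"
    by (meson bounded_closed_interval bounded_subset closed_closure compact_eq_bounded_closed)
  moreover have "ereal x < T" if "x \<le> a + \<epsilon>" for x
    using that a(4) by (meson ereal_less_eq(3) le_less_trans)
  ultimately show ?thesis unfolding test_fun_def by (auto simp: subset_iff)
qed

section \<open>Testing the equation\<close>

text \<open>Bridge between the pairings, which integrate over \<open>lebesgue\<close>, and the
  causal Borel functions, which agree with the given data only almost everywhere and are integrated
  over \<open>lborel\<close>.\<close>

lemma borel_measurable_lebesgue_AE_eq:
  fixes f g :: "real \<Rightarrow> real"
  assumes "g \<in> borel_measurable borel" "AE x in lborel. f x = g x"
  shows "f \<in> borel_measurable lebesgue" "integral\<^sup>L lebesgue f = integral\<^sup>L lborel g"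
proof -
  have g: "g \<in> borel_measurable lebesgue" using assms(1) by (simp add: measurable_completion)
  have ae: "AE x in lebesgue. f x = g x" using assms(2) by (rule AE_completion)
  show f: "f \<in> borel_measurable lebesgue"
    using g ae by (intro borel_measurable_AE[of g f]) (auto elim: eventually_mono)
  have "integral\<^sup>L lebesgue f = integral\<^sup>L lebesgue g"
    by (intro integral_cong_AE f g ae)
  also have "\<dots> = integral\<^sup>L lborel g" using assms(1) by (intro integral_completion) simp
  finally show "integral\<^sup>L lebesgue f = integral\<^sup>L lborel g" .
qed

text \<open>Fubini after the substitution \<open>s = x + y\<close>: the fractional integral moves
  from the test side to \<open>p\<close>. Integrability holds because \<open>p\<close> vanishes at
  negative times and the bounded \<open>\<rho>\<close> vanishes from \<open>R\<close> on.\<close>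

lemma rl_int_dual:
  fixes \<rho> :: "real \<Rightarrow> real"
  assumes "\<beta> > 0" "causal p" and [measurable]: "\<rho> \<in> borel_measurable borel"
    and bd: "\<And>x. \<bar>\<rho> x\<bar> \<le> C" and supp: "\<And>x. x \<ge> R \<Longrightarrow> \<rho> x = 0"
  shows "(\<integral>y. p y * (\<integral>x. rl_kernel \<beta> x * \<rho> (x + y) \<partial>lborel) \<partial>lborel) = (\<integral>s. \<rho> s * rl_int \<beta> p s \<partial>lborel)"
proof -
  note [measurable] = causal_measurable[OF assms(2)]
  let ?F = "\<lambda>s y. \<rho> s * (rl_kernel \<beta> (s - y) * p y)"
  have C0: "C \<ge> 0" using bd[of 0] by linarith
  have F: "has_bochner_integral lborel (\<lambda>y. rl_kernel \<beta> (s - y) * q y) (rl_int \<beta> q s)" if "causal q" for q s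
    using rl_int_integrable[OF assms(1) that, of s]
      lborel_integrable_real_affine_iff[of "-1" "\<lambda>y. rl_kernel \<beta> (s - y) * q y" s]
      lborel_integral_real_affine[of "-1" "\<lambda>y. rl_kernel \<beta> (s - y) * q y" s]
    by (simp add: has_bochner_integral_iff rl_int_def)
  have int: "integrable (lborel \<Otimes>\<^sub>M lborel) (\<lambda>(s, y). ?F s y)"
  proof (rule lborel_pair.Fubini_integrable)
    have abs: "causal (\<lambda>t. \<bar>p t\<bar>)" by (intro causal_abs assms)
    have J: "causal (rl_int \<beta> (\<lambda>t. \<bar>p t\<bar>))" by (intro causal_rl_int assms abs)
    note [measurable] = causal_measurable[OF J]
    have "integrable lborel (\<lambda>s. \<bar>\<rho> s\<bar> * rl_int \<beta> (\<lambda>t. \<bar>p t\<bar>) s)"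
    proof (rule Bochner_Integration.integrable_bound)
      show "integrable lborel (\<lambda>s. C * (indicator {..<R} s * rl_int \<beta> (\<lambda>t. \<bar>p t\<bar>) s))"
        by (intro integrable_mult_right causal_integrable J)
      show "AE s in lborel. norm (\<bar>\<rho> s\<bar> * rl_int \<beta> (\<lambda>t. \<bar>p t\<bar>) s)
        \<le> norm (C * (indicator {..<R} s * rl_int \<beta> (\<lambda>t. \<bar>p t\<bar>) s))"
      proof (intro AE_I2)
        fix s
        show "norm (\<bar>\<rho> s\<bar> * rl_int \<beta> (\<lambda>t. \<bar>p t\<bar>) s) \<le> norm (C * (indicator {..<R} s * rl_int \<beta> (\<lambda>t. \<bar>p t\<bar>) s))"
          using bd[of s] supp[of s] C0 by (cases "s < R") (auto simp: abs_mult intro!: mult_right_mono)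
      qed
    qed measurable
    moreover have "(\<integral>y. norm (?F s y) \<partial>lborel) = \<bar>\<rho> s\<bar> * rl_int \<beta> (\<lambda>t. \<bar>p t\<bar>) s" for s
    proof -
      have "norm (?F s y) = \<bar>\<rho> s\<bar> * (rl_kernel \<beta> (s - y) * \<bar>p y\<bar>)" for y
        using rl_kernel_nonneg[OF assms(1), of "s - y"] by (simp add: abs_mult)
      then show ?thesis using F[OF abs, of s] by (simp add: has_bochner_integral_iff)
    qed
    ultimately show "integrable lborel (\<lambda>s. LINT y|lborel. norm (case (s, y) of (s, y) \<Rightarrow> ?F s y))"
      by simp
    show "AE s in lborel. integrable lborel (\<lambda>y. case (s, y) of (s, y) \<Rightarrow> ?F s y)"
      using F[OF assms(2)] by (auto simp: has_bochner_integral_iff intro!: AE_I2 integrable_mult_right)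
  qed measurable
  have "(\<integral>x. rl_kernel \<beta> x * \<rho> (x + y) \<partial>lborel) = (\<integral>s. rl_kernel \<beta> (s - y) * \<rho> s \<partial>lborel)" for y
    using lborel_integral_real_affine[of 1 "\<lambda>x. rl_kernel \<beta> x * \<rho> (x + y)" "-y"] by simp
  then have "(\<integral>y. p y * (\<integral>x. rl_kernel \<beta> x * \<rho> (x + y) \<partial>lborel) \<partial>lborel) = (\<integral>y. (\<integral>s. ?F s y \<partial>lborel) \<partial>lborel)"
    by (simp add: integral_mult_right_zero[symmetric] mult_ac del: integral_mult_right_zero integral_mult_left_zero)
  also have "\<dots> = (\<integral>s. (\<integral>y. ?F s y \<partial>lborel) \<partial>lborel)"
    using lborel_pair.Fubini_integral[OF int] by simp
  also have "\<dots> = (\<integral>s. \<rho> s * rl_int \<beta> p s \<partial>lborel)"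
    using has_bochner_integral_integral_eq[OF F[OF assms(2)]] by simp
  finally show ?thesis .
qed

text \<open>On nonnegative times the test function is a smooth version of the indicator of
  \<open>{..<a}\<close>, and its derivative is minus a mollifier at \<open>a\<close>. So one side
  tends to \<open>rl_int (1 - \<gamma>) U a\<close>, the other to the primitive of \<open>H\<close>.
  The gap between \<open>a\<close> and \<open>R\<close> leaves room for the step.\<close>

lemma caputo_eq_imp_rl_int_eq:
  assumes \<gamma>: "0 < \<gamma>" "\<gamma> < 1" and T: "ereal R < T"
    and eq: "distr_eq T (caputo \<gamma> u0 u) (distr_of (\<lambda>t. heaviside t * h t))"
    and U: "causal U" "AE t in lborel. 0 \<le> t \<and> t \<le> R \<longrightarrow> U t = u t - u0"
    and H: "causal H" "AE t in lborel. 0 \<le> t \<and> t \<le> R \<longrightarrow> H t = h t"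
    and a: "0 \<le> a" "a < R"
  shows "rl_int (1 - \<gamma>) U a = rl_int 1 H a"
proof -
  obtain S \<rho> :: "real \<Rightarrow> real" where S: "\<And>x. (S has_field_derivative \<rho> x) (at x)"
      "\<And>n x. (deriv ^^ n) S field_differentiable (at x)"
      "\<And>x. x \<le> -1 \<Longrightarrow> S x = 0" "\<And>x. 1 \<le> x \<Longrightarrow> S x = 1" "\<And>x. 0 \<le> S x" "\<And>x. S x \<le> 1"
    and \<rho>: "\<And>x. \<rho> x \<ge> 0" "\<And>x. \<bar>x\<bar> \<ge> 1 \<Longrightarrow> \<rho> x = 0" "\<And>x. isCont \<rho> x" "has_bochner_integral lborel \<rho> 1"
    by (rule smooth_step_exists) blast
  note [measurable] = causal_measurable[OF U(1)] causal_measurable[OF H(1)]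
  have \<rho>_meas [measurable]: "\<rho> \<in> borel_measurable borel"
    using \<rho>(3) by (intro borel_measurable_continuous_onI continuous_at_imp_continuous_on) auto
  have S_meas [measurable]: "S \<in> borel_measurable borel"
    using S(1) by (intro borel_measurable_continuous_onI continuous_at_imp_continuous_on) (auto intro: DERIV_isCont)
  have "\<exists>C. \<forall>x. -1 \<le> x \<and> x \<le> 1 \<longrightarrow> \<rho> x \<le> C"
    using isCont_eq_Ub[of "-1" 1 \<rho>] \<rho>(3) by auto
  then obtain C where "\<And>x. \<lbrakk>-1 \<le> x; x \<le> 1\<rbrakk> \<Longrightarrow> \<rho> x \<le> C" by blast
  then have C: "\<bar>\<rho> x\<bar> \<le> max C 0" for x
    using \<rho>(1,2)[of x] by (cases "\<bar>x\<bar> \<ge> 1") (auto simp: abs_le_iff le_max_iff_disj)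
  have G: "Gamma (1 - \<gamma>) > 0" using \<gamma> by (intro Gamma_real_pos) auto
  let ?J = "rl_int (1 - \<gamma>) U"
  have J: "causal ?J" using \<gamma> U by (intro causal_rl_int) auto
  note [measurable] = causal_measurable[OF J]
  have approx: "(\<integral>x. \<rho> x * ?J (a + \<epsilon> * x) \<partial>lborel) = (\<integral>t. H t * (1 - S ((t - a) / \<epsilon>)) \<partial>lborel)"
    if \<epsilon>: "0 < \<epsilon>" "\<epsilon> \<le> 1" "a + \<epsilon> \<le> R" for \<epsilon>
  proof -
    define \<phi> where "\<phi> t = S (t + 3) - S ((t - a) / \<epsilon>)" for t
    define \<rho>\<epsilon> where "\<rho>\<epsilon> s = \<rho> ((s - a) / \<epsilon>) / \<epsilon>" for s
    have [measurable]: "\<rho>\<epsilon> \<in> borel_measurable borel" unfolding \<rho>\<epsilon>_def by measurable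
    define \<Psi> where "\<Psi> y = (\<integral>x. rl_kernel (1 - \<gamma>) x * \<rho>\<epsilon> (x + y) \<partial>lborel)" for y
    have [measurable]: "\<Psi> \<in> borel_measurable borel" unfolding \<Psi>_def by measurable
    have \<rho>\<epsilon>_supp: "\<rho>\<epsilon> s = 0" if "s \<ge> a + \<epsilon>" for s
    proof -
      have "(s - a) / \<epsilon> \<ge> 1" using that \<epsilon> by (simp add: field_simps)
      then have "\<bar>(s - a) / \<epsilon>\<bar> \<ge> 1" by linarith
      from \<rho>(2)[OF this] show ?thesis by (simp only: \<rho>\<epsilon>_def div_0)
    qed
    have \<phi>': "(\<phi> has_field_derivative \<rho> (t + 3) - \<rho>\<epsilon> t) (at t)" for t
      unfolding \<phi>_def[abs_def] \<rho>\<epsilon>_def using \<epsilon>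
      by (auto intro!: derivative_eq_intros DERIV_chain'[OF _ S(1)])
    \<comment> \<open>The minus signs of \<open>distr_deriv\<close> and of
      \<open>- \<rho>\<epsilon>\<close> cancel, and \<open>S (t + 3)\<close> is constant on the
      nonnegative arguments met here.\<close>
    have \<psi>: "g_neg \<gamma> (\<lambda>x. \<phi> (x + y)) = \<Psi> y" if y: "y \<ge> 0" for y
    proof -
      have "deriv (\<lambda>x. \<phi> (x + y)) t = \<rho> (t + y + 3) - \<rho>\<epsilon> (t + y)" for t
        using DERIV_shift[of \<phi> _ t y] \<phi>'[of "t + y"] by (intro DERIV_imp_deriv) blast
      then have "heaviside t * t powr - \<gamma> * deriv (\<lambda>x. \<phi> (x + y)) t
          = - Gamma (1 - \<gamma>) * (rl_kernel (1 - \<gamma>) t * \<rho>\<epsilon> (t + y))" for t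
        using y \<rho>(2)[of "t + y + 3"] G by (auto simp: heaviside_def rl_kernel_def indicator_def)
      then have "g_neg \<gamma> (\<lambda>x. \<phi> (x + y)) = 1 / Gamma (1 - \<gamma>) *
          - (LINT t|lebesgue. - Gamma (1 - \<gamma>) * (rl_kernel (1 - \<gamma>) t * \<rho>\<epsilon> (t + y)))"
        by (simp only: g_neg_def distr_deriv_def distr_of_def)
      also have "(LINT t|lebesgue. - Gamma (1 - \<gamma>) * (rl_kernel (1 - \<gamma>) t * \<rho>\<epsilon> (t + y)))
        = (\<integral>t. - Gamma (1 - \<gamma>) * (rl_kernel (1 - \<gamma>) t * \<rho>\<epsilon> (t + y)) \<partial>lborel)"
        by (intro integral_completion) simp
      finally show ?thesis using G by (simp add: \<Psi>_def)
    qed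
    \<comment> \<open>\<open>U\<close> and \<open>H\<close> represent the data only up to
      \<open>R\<close>; past \<open>R\<close> both test factors have to vanish.\<close>
    have \<Psi>_supp: "\<Psi> y = 0" if "y > R" for y
    proof -
      have "(\<lambda>x. rl_kernel (1 - \<gamma>) x * \<rho>\<epsilon> (x + y)) = (\<lambda>x. 0)"
        using that \<epsilon> \<rho>\<epsilon>_supp by (auto simp: rl_kernel_def fun_eq_iff)
      then show ?thesis by (simp only: \<Psi>_def integral_zero)
    qed
    have \<phi>_supp: "\<phi> t = 0" if "t > R" for t
    proof -
      have "(t - a) / \<epsilon> \<ge> 1" "t + 3 \<ge> 1" using that \<epsilon> a by (auto simp: field_simps)
      then show ?thesis by (simp add: \<phi>_def S)
    qed
    have "ereal (a + \<epsilon>) < T" using \<epsilon> T by (meson ereal_less_eq(3) le_less_trans)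
    then have "test_fun T \<phi>"
      unfolding \<phi>_def[abs_def] using a \<epsilon> by (intro test_fun_cutoff S) auto
    then have "caputo \<gamma> u0 u \<phi> = distr_of (\<lambda>t. heaviside t * h t) \<phi>"
      using eq by (simp add: distr_eq_def)
    moreover have "caputo \<gamma> u0 u \<phi> = (\<integral>y. U y * \<Psi> y \<partial>lborel)"
      unfolding caputo_def distr_conv_def distr_of_def
    proof (rule borel_measurable_lebesgue_AE_eq(2))
      show "AE y in lborel. (u y - u0) * heaviside y * g_neg \<gamma> (\<lambda>x. \<phi> (x + y)) = U y * \<Psi> y"
        using U(2)
      proof eventually_elim
        case (elim y)
        consider "y < 0" | "0 \<le> y" "y \<le> R" | "y > R" "y \<ge> 0" by linarith
        then show ?case
          using elim \<psi>[of y] \<Psi>_supp[of y] causal_neg[OF U(1), of y]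
          by cases (auto simp: heaviside_def)
      qed
    qed measurable
    moreover have "distr_of (\<lambda>t. heaviside t * h t) \<phi> = (\<integral>t. H t * (1 - S ((t - a) / \<epsilon>)) \<partial>lborel)"
      unfolding distr_of_def
    proof (rule borel_measurable_lebesgue_AE_eq(2))
      show "AE t in lborel. heaviside t * h t * \<phi> t = H t * (1 - S ((t - a) / \<epsilon>))"
        using H(2)
      proof eventually_elim
        case (elim t)
        have \<phi>t: "\<phi> t = 1 - S ((t - a) / \<epsilon>)" if "t \<ge> 0" using that by (simp add: \<phi>_def S)
        consider "t < 0" | "0 \<le> t" "t \<le> R" | "t > R" "t \<ge> 0" by linarith
        then show ?case
          using elim \<phi>t \<phi>_supp[of t] causal_neg[OF H(1), of t]
          by cases (auto simp: heaviside_def)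
      qed
    qed measurable
    moreover have "(\<integral>y. U y * \<Psi> y \<partial>lborel) = (\<integral>s. \<rho>\<epsilon> s * ?J s \<partial>lborel)"
      unfolding \<Psi>_def
    proof (rule rl_int_dual[where C = "max C 0 / \<epsilon>" and R = R])
      show "\<bar>\<rho>\<epsilon> x\<bar> \<le> max C 0 / \<epsilon>" for x
        using C \<epsilon> by (auto simp: \<rho>\<epsilon>_def abs_divide intro!: divide_right_mono)
    qed (use \<gamma> U \<rho>\<epsilon>_supp \<epsilon> in auto)
    moreover have "(\<integral>s. \<rho>\<epsilon> s * ?J s \<partial>lborel) = (\<integral>x. \<rho> x * ?J (a + \<epsilon> * x) \<partial>lborel)"
      using lborel_integral_real_affine[of \<epsilon> "\<lambda>s. \<rho>\<epsilon> s * ?J s" a] \<epsilon>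
      by (simp add: \<rho>\<epsilon>_def)
    ultimately show ?thesis by simp
  qed
  \<comment> \<open>The factor \<open>min 1 (R - a)\<close> makes every \<open>\<epsilon> n\<close>
    admissible in \<open>approx\<close>.\<close>
  define \<epsilon> where "\<epsilon> n = min 1 (R - a) / real (Suc n)" for n
  have \<epsilon>: "0 < \<epsilon> n" "\<epsilon> n \<le> 1" "a + \<epsilon> n \<le> R" for n
  proof -
    have "\<epsilon> n \<le> min 1 (R - a) / 1" unfolding \<epsilon>_def using a by (intro divide_left_mono) auto
    then show "0 < \<epsilon> n" "\<epsilon> n \<le> 1" "a + \<epsilon> n \<le> R" using a by (auto simp: \<epsilon>_def)
  qed
  have \<epsilon>0: "\<epsilon> \<longlonglongrightarrow> 0" unfolding \<epsilon>_def by (rule LIMSEQ_Suc[OF lim_const_over_n])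
  obtain B where B: "\<forall>t\<le>R. \<bar>?J t\<bar> \<le> B" using J unfolding causal_def by meson
  \<comment> \<open>Continuity of \<open>?J\<close> recovers its value at \<open>a\<close>, since
    \<open>\<rho>\<close> has integral \<open>1\<close>. The bound \<open>B\<close> on
    \<open>{..R}\<close> is enough because \<open>\<rho>\<close> vanishes outside
    \<open>{-1..1}\<close>.\<close>
  have "(\<lambda>n. \<integral>x. \<rho> x * ?J (a + \<epsilon> n * x) \<partial>lborel) \<longlonglongrightarrow> (\<integral>x. \<rho> x * ?J a \<partial>lborel)"
  proof (rule integral_dominated_convergence[where w = "\<lambda>x. B * \<rho> x"])
    show "integrable lborel (\<lambda>x. B * \<rho> x)" using \<rho>(4) by (auto simp: has_bochner_integral_iff)
    show "AE x in lborel. (\<lambda>n. \<rho> x * ?J (a + \<epsilon> n * x)) \<longlonglongrightarrow> \<rho> x * ?J a"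
    proof (intro AE_I2)
      fix x
      have "(\<lambda>n. a + \<epsilon> n * x) \<longlonglongrightarrow> a + 0 * x" by (intro tendsto_intros \<epsilon>0)
      then have "(\<lambda>n. a + \<epsilon> n * x) \<longlonglongrightarrow> a" by simp
      then have "(\<lambda>n. ?J (a + \<epsilon> n * x)) \<longlonglongrightarrow> ?J a"
        using \<gamma> U by (intro isCont_tendsto_compose[OF isCont_rl_int]) auto
      then show "(\<lambda>n. \<rho> x * ?J (a + \<epsilon> n * x)) \<longlonglongrightarrow> \<rho> x * ?J a" by (intro tendsto_intros)
    qed
    show "AE x in lborel. norm (\<rho> x * ?J (a + \<epsilon> n * x)) \<le> B * \<rho> x" for n
    proof (intro AE_I2)
      fix x
      show "norm (\<rho> x * ?J (a + \<epsilon> n * x)) \<le> B * \<rho> x"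
      proof (cases "\<bar>x\<bar> \<ge> 1")
        case False
        then have "\<epsilon> n * x \<le> \<epsilon> n * 1" using \<epsilon>[of n] by (intro mult_left_mono) auto
        then have "a + \<epsilon> n * x \<le> R" using \<epsilon>[of n] by linarith
        then have "\<bar>?J (a + \<epsilon> n * x)\<bar> * \<rho> x \<le> B * \<rho> x" using B \<rho>(1) by (intro mult_right_mono) auto
        then show ?thesis using \<rho>(1)[of x] by (simp add: abs_mult mult.commute)
      qed (simp add: \<rho>)
    qed
  qed measurable
  moreover have "(\<lambda>n. \<integral>x. \<rho> x * ?J (a + \<epsilon> n * x) \<partial>lborel) \<longlonglongrightarrow> (\<integral>t. indicator {..<a} t * H t \<partial>lborel)"
    unfolding approx[OF \<epsilon>]
  proof (rule integral_dominated_convergence[where w = "\<lambda>t. \<bar>indicator {..<R} t * H t\<bar>"])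
    show "integrable lborel (\<lambda>t. \<bar>indicator {..<R} t * H t\<bar>)"
      by (intro integrable_abs causal_integrable H)
    show "AE t in lborel. (\<lambda>n. H t * (1 - S ((t - a) / \<epsilon> n))) \<longlonglongrightarrow> indicator {..<a} t * H t"
      using AE_lborel_singleton[of a]
    proof eventually_elim
      case (elim t)
      \<comment> \<open>Once \<open>\<epsilon> n < \<bar>t - a\<bar>\<close>, the scaled step is
        exactly \<open>0\<close> or \<open>1\<close>, so the sequence is eventually
        constant.\<close>
      have "\<forall>\<^sub>F n in sequentially. \<epsilon> n < \<bar>t - a\<bar>"
        using elim by (intro order_tendstoD(2)[OF \<epsilon>0]) auto
      then have "\<forall>\<^sub>F n in sequentially. H t * (1 - S ((t - a) / \<epsilon> n)) = indicator {..<a} t * H t"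
      proof eventually_elim
        case (elim n)
        show ?case
        proof (cases "t < a")
          case True
          then have "(t - a) / \<epsilon> n \<le> -1" using elim \<epsilon>(1)[of n] by (simp add: field_simps)
          then show ?thesis using True by (simp add: S)
        next
          case False
          then have "(t - a) / \<epsilon> n \<ge> 1" using elim \<epsilon>(1)[of n] by (simp add: field_simps)
          then show ?thesis using False by (simp add: S)
        qed
      qed
      then show ?case by (rule tendsto_eventually)
    qed
    show "AE t in lborel. norm (H t * (1 - S ((t - a) / \<epsilon> n))) \<le> \<bar>indicator {..<R} t * H t\<bar>" for n
    proof (intro AE_I2)
      fix t
      show "norm (H t * (1 - S ((t - a) / \<epsilon> n))) \<le> \<bar>indicator {..<R} t * H t\<bar>"
      proof (cases "t < R")
        case True
        have "\<bar>1 - S ((t - a) / \<epsilon> n)\<bar> \<le> 1" using S(5,6)[of "(t - a) / \<epsilon> n"] by auto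
        then show ?thesis using True by (simp add: abs_mult mult_left_le)
      next
        case False
        then have "(t - a) / \<epsilon> n \<ge> 1" using \<epsilon>[of n] by (simp add: field_simps)
        then show ?thesis by (simp add: S)
      qed
    qed
  qed measurable
  ultimately have "(\<integral>x. \<rho> x * ?J a \<partial>lborel) = (\<integral>t. indicator {..<a} t * H t \<partial>lborel)"
    by (rule LIMSEQ_unique)
  then show ?thesis using \<rho>(4) by (simp add: rl_int_1 has_bochner_integral_iff)
qed

section \<open>Bounds on rectangles and causal representatives\<close>

lemma AE_le_Linf_norm:
  fixes u :: "'a::euclidean_space \<Rightarrow> real"
  assumes "K \<in> sets lebesgue" "Linf_norm K u \<le> ereal M"
  shows "AE x in lborel. x \<in> K \<longrightarrow> \<bar>u x\<bar> \<le> M"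
proof -
  have "AE x in lebesgue_on K. ereal \<bar>u x\<bar> \<le> ereal M"
    using esssup_AE[of "\<lambda>x. ereal \<bar>u x\<bar>" "lebesgue_on K"]
  proof eventually_elim
    case (elim x)
    then show ?case using assms(2) unfolding Linf_norm_def by (rule order_trans)
  qed
  then have "AE x in lebesgue. x \<in> K \<longrightarrow> \<bar>u x\<bar> \<le> M"
    using assms(1) by (simp add: AE_restrict_space_iff)
  then show ?thesis by (simp add: AE_completion_iff)
qed

lemma Linf_norm_finite_bound:
  fixes u :: "'a::euclidean_space \<Rightarrow> real"
  assumes "K \<in> sets lebesgue" "Linf_norm K u < \<infinity>"
  obtains M where "M > 0" "AE x in lborel. x \<in> K \<longrightarrow> \<bar>u x\<bar> \<le> M"
proof -
  obtain M0 where "Linf_norm K u \<le> ereal M0"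
    using assms(2) by (cases "Linf_norm K u") auto
  then have "Linf_norm K u \<le> ereal (max 1 M0)"
    by (rule order_trans) simp
  with AE_le_Linf_norm[OF assms(1)] that[of "max 1 M0"] show ?thesis by simp
qed

lemma Lipschitz_on_rectangle:
  assumes "loc_Lipschitz_ae f"
  obtains L where "L > 0"
    "AE t in lborel. 0 \<le> t \<and> t \<le> R \<longrightarrow> (\<forall>v w. \<bar>v\<bar> \<le> M \<and> \<bar>w\<bar> \<le> M \<longrightarrow> \<bar>f (t, v) - f (t, w)\<bar> \<le> L * \<bar>v - w\<bar>)"
proof -
  have "compact ({0..R} \<times> {-M..M}) \<and> {0..R} \<times> {-M..M} \<subseteq> {0..} \<times> UNIV"
    by (auto intro: compact_Times)
  then obtain L where L: "L > 0" "AE t in lebesgue. \<forall>u v. (t, u) \<in> {0..R} \<times> {-M..M} \<and> (t, v) \<in> {0..R} \<times> {-M..M}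
      \<longrightarrow> \<bar>f (t, u) - f (t, v)\<bar> \<le> L * \<bar>u - v\<bar>"
    using assms unfolding loc_Lipschitz_ae_def by meson
  have "AE t in lborel. 0 \<le> t \<and> t \<le> R \<longrightarrow> (\<forall>v w. \<bar>v\<bar> \<le> M \<and> \<bar>w\<bar> \<le> M \<longrightarrow> \<bar>f (t, v) - f (t, w)\<bar> \<le> L * \<bar>v - w\<bar>)"
    using L(2) unfolding AE_completion_iff by eventually_elim (auto simp: abs_le_iff)
  with L(1) that show ?thesis by blast
qed

text \<open>A bound almost everywhere in the plane says nothing along a graph
  \<open>(t, u t)\<close>, which is a null set; therefore the bound is obtained for almost every
  \<open>t\<close> and all \<open>v\<close>, with a constant enlarged by means of the Lipschitz
  condition.\<close>

lemma bounded_on_rectangle: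
  assumes "Linf_loc ({0..} \<times> UNIV) f" "loc_Lipschitz_ae f" "M > 0"
  obtains B where "B > 0" "AE t in lborel. 0 \<le> t \<and> t \<le> R \<longrightarrow> (\<forall>v. \<bar>v\<bar> \<le> M \<longrightarrow> \<bar>f (t, v)\<bar> \<le> B)"
proof -
  let ?K = "{0..R} \<times> {-M..M}"
  have K: "compact ?K" "?K \<subseteq> {0..} \<times> UNIV" by (auto intro: compact_Times)
  then have "?K \<in> sets lebesgue" by (intro sets_completionI_sets) (simp add: borel_compact)
  moreover have "Linf_norm ?K f < \<infinity>" using assms(1) K unfolding Linf_loc_def by blast
  ultimately obtain B where B: "B > 0" "AE x in lborel. x \<in> ?K \<longrightarrow> \<bar>f x\<bar> \<le> B"
    using Linf_norm_finite_bound by blast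
  \<comment> \<open>By Fubini almost every section is bounded by \<open>B\<close> at some point, and the Lipschitz condition
    spreads this bound over the whole section.\<close>
  obtain L where L: "L > 0"
    "AE t in lborel. 0 \<le> t \<and> t \<le> R \<longrightarrow> (\<forall>v w. \<bar>v\<bar> \<le> M \<and> \<bar>w\<bar> \<le> M \<longrightarrow> \<bar>f (t, v) - f (t, w)\<bar> \<le> L * \<bar>v - w\<bar>)"
    using Lipschitz_on_rectangle[OF assms(2)] .
  have "AE x in lborel \<Otimes>\<^sub>M lborel. x \<in> ?K \<longrightarrow> \<bar>f x\<bar> \<le> B" unfolding lborel_prod by (rule B(2))
  then have "AE t in lborel. AE v in lborel. (t, v) \<in> ?K \<longrightarrow> \<bar>f (t, v)\<bar> \<le> B"
    by (rule lborel_pair.AE_pair)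
  with L(2) have "AE t in lborel. 0 \<le> t \<and> t \<le> R \<longrightarrow> (\<forall>v. \<bar>v\<bar> \<le> M \<longrightarrow> \<bar>f (t, v)\<bar> \<le> B + L * (2 * M))"
  proof eventually_elim
    case (elim t)
    show ?case
    proof (intro impI allI)
      fix v assume t: "0 \<le> t \<and> t \<le> R" and v: "\<bar>v\<bar> \<le> M"
      have "\<exists>w. \<bar>w\<bar> \<le> M \<and> \<bar>f (t, w)\<bar> \<le> B"
      proof (rule ccontr)
        assume "\<not> ?thesis"
        then have "AE w in lborel. w \<notin> {-M..M}"
          using elim(2) t by (auto elim!: eventually_mono simp: abs_le_iff)
        then have "{-M..M} \<in> null_sets lborel"
          by (subst AE_iff_null_sets) auto
        then show False using assms(3) by (auto dest: null_setsD1)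
      qed
      then obtain w where w: "\<bar>w\<bar> \<le> M" "\<bar>f (t, w)\<bar> \<le> B" by blast
      have "\<bar>f (t, v) - f (t, w)\<bar> \<le> L * \<bar>v - w\<bar>" using elim(1) t v w by blast
      also have "\<dots> \<le> L * (2 * M)" using v w L(1) by (intro mult_left_mono) auto
      finally show "\<bar>f (t, v)\<bar> \<le> B + L * (2 * M)" using w by linarith
    qed
  qed
  moreover have "B + L * (2 * M) > 0" using B(1) L(1) assms(3) by (simp add: add_pos_pos)
  ultimately show ?thesis using that by blast
qed

text \<open>Passes from Lebesgue to Borel measurability at the price of a null set. Clamping to
  \<open>{-M..M}\<close> turns the almost everywhere bound into one everywhere, as
  \<open>causal\<close> demands.\<close>

lemma causal_representative:
  assumes g: "set_integrable lebesgue {0..R} g" and bd: "AE t in lborel. 0 \<le> t \<and> t \<le> R \<longrightarrow> \<bar>g t\<bar> \<le> M" and "M > 0"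
  obtains p where "causal p" "AE t in lborel. 0 \<le> t \<and> t \<le> R \<longrightarrow> p t = g t"
proof -
  have "(\<lambda>t. indicator {0..R} t *\<^sub>R g t) \<in> borel_measurable (completion lborel)"
    using g unfolding set_integrable_def by (rule borel_measurable_integrable)
  then obtain q where [measurable]: "q \<in> borel_measurable lborel" and q: "AE t in lborel. indicator {0..R} t *\<^sub>R g t = q t"
    using completion_ex_borel_measurable_real by blast
  let ?p = "\<lambda>t. if 0 \<le> t then max (- M) (min M (q t)) else 0"
  have "causal ?p"
    unfolding causal_def
  proof (intro conjI allI impI)
    show "?p \<in> borel_measurable borel" by measurable
    show "\<exists>B. \<forall>t\<le>R. \<bar>?p t\<bar> \<le> B" for R using \<open>M > 0\<close> by (intro exI[of _ M]) auto
  qed auto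
  moreover have "AE t in lborel. 0 \<le> t \<and> t \<le> R \<longrightarrow> ?p t = g t"
    using q bd by eventually_elim (auto simp: abs_le_iff)
  ultimately show ?thesis using that by blast
qed

section \<open>Integral equations for solutions and their differences\<close>

text \<open>The tested equation is inverted for causal representatives of \<open>u - u0\<close> and
  \<open>f (t, u t)\<close>, which gives the equation for \<open>u\<close> almost everywhere. For
  \<open>cont_rep\<close> it holds at every \<open>t \<le> R\<close>, because the integral does not
  see the null set where \<open>H\<close> differs from \<open>f (t, u t)\<close>.\<close>

lemma strong_solution_Volterra:
  assumes \<gamma>: "0 < \<gamma>" "\<gamma> < 1" and f: "Linf_loc ({0..} \<times> UNIV) f" "loc_Lipschitz_ae f"
    and sol: "strong_solution \<gamma> f T u0 u" and R: "0 < R" "ereal R < T"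
    and M: "M > 0" "AE t in lborel. 0 \<le> t \<and> t \<le> R \<longrightarrow> \<bar>u t\<bar> \<le> M"
  obtains H where "causal H" "AE t in lborel. 0 \<le> t \<and> t \<le> R \<longrightarrow> H t = f (t, u t)"
    "AE t in lborel. 0 \<le> t \<and> t \<le> R \<longrightarrow> u t = u0 + rl_int \<gamma> H t"
    "\<And>t. t \<le> R \<Longrightarrow> cont_rep \<gamma> f u0 u t = u0 + rl_int \<gamma> H t"
proof -
  obtain B where B: "B > 0" "AE t in lborel. 0 \<le> t \<and> t \<le> R \<longrightarrow> (\<forall>v. \<bar>v\<bar> \<le> M \<longrightarrow> \<bar>f (t, v)\<bar> \<le> B)"
    using bounded_on_rectangle[OF f M(1)] .
  have "AE t in lborel. 0 \<le> t \<and> t \<le> R \<longrightarrow> \<bar>f (t, u t)\<bar> \<le> B"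
    using B(2) M(2) by eventually_elim auto
  moreover have "set_integrable lebesgue {0..R} (\<lambda>t. f (t, u t))"
    using sol R by (auto simp: strong_solution_def L1_loc_def)
  ultimately obtain H where H: "causal H" "AE t in lborel. 0 \<le> t \<and> t \<le> R \<longrightarrow> H t = f (t, u t)"
    using causal_representative[of R "\<lambda>t. f (t, u t)" B] B(1) by blast
  have "set_integrable lebesgue {0..R} u"
    using sol R by (auto simp: strong_solution_def L1_loc_def)
  moreover have "set_integrable lebesgue {0..R} (\<lambda>_. u0)"
    unfolding set_integrable_def by (subst integrable_completion) (simp_all add: emeasure_lborel_Icc_eq)
  ultimately have "set_integrable lebesgue {0..R} (\<lambda>t. u t - u0)" by (rule set_integral_diff)
  moreover have "AE t in lborel. 0 \<le> t \<and> t \<le> R \<longrightarrow> \<bar>u t - u0\<bar> \<le> M + \<bar>u0\<bar>"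
    using M(2) by eventually_elim auto
  ultimately obtain U where U: "causal U" "AE t in lborel. 0 \<le> t \<and> t \<le> R \<longrightarrow> U t = u t - u0"
    using causal_representative[of R "\<lambda>t. u t - u0" "M + \<bar>u0\<bar>"] M(1) by (auto simp: add_pos_nonneg)
  have deq: "distr_eq T (caputo \<gamma> u0 u) (distr_of (\<lambda>t. heaviside t * f (t, u t)))"
    using sol by (simp add: strong_solution_def)
  have J: "rl_int (1 - \<gamma>) U t = rl_int 1 H t" if "t < R" for t
  proof (cases "t \<ge> 0")
    case True
    then show ?thesis
      using caputo_eq_imp_rl_int_eq[OF \<gamma> R(2) deq U H(1)] H(2) that by blast
  qed (simp add: rl_int_nonpos U H)
  \<comment> \<open>Testing reaches only \<open>t < R\<close>; the endpoint follows by continuity of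
    both fractional integrals.\<close>
  have "rl_int (1 - \<gamma>) U R = rl_int 1 H R"
  proof (rule tendsto_unique)
    show "(rl_int (1 - \<gamma>) U \<longlongrightarrow> rl_int (1 - \<gamma>) U R) (at_left R)"
      using isCont_rl_int[of "1 - \<gamma>" U R] \<gamma> U(1) by (simp add: isCont_def filterlim_at_split)
    have "(rl_int 1 H \<longlongrightarrow> rl_int 1 H R) (at_left R)"
      using isCont_rl_int[of 1 H R] H(1) by (simp add: isCont_def filterlim_at_split)
    moreover have "\<forall>\<^sub>F t in at_left R. rl_int 1 H t = rl_int (1 - \<gamma>) U t"
      using J by (simp add: eventually_at_filter)
    ultimately show "(rl_int (1 - \<gamma>) U \<longlongrightarrow> rl_int 1 H R) (at_left R)"
      by (rule Lim_transform_eventually)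
  qed simp
  with J have "rl_int (1 - \<gamma>) U t = rl_int 1 H t" if "t \<le> R" for t
    using that by (cases "t = R") auto
  then have inv: "AE t in lborel. t < R \<longrightarrow> U t = rl_int \<gamma> H t"
    by (intro rl_int_inversion \<gamma> U H)
  show ?thesis
  proof (rule that[OF H])
    show "AE t in lborel. 0 \<le> t \<and> t \<le> R \<longrightarrow> u t = u0 + rl_int \<gamma> H t"
      using inv U(2) AE_lborel_singleton[of R] by eventually_elim auto
    fix t assume t: "t \<le> R"
    note [measurable] = causal_measurable[OF H(1)]
    have G: "Gamma \<gamma> > 0" using \<gamma> by (intro Gamma_real_pos)
    \<comment> \<open>At \<open>s = t\<close> both integrands vanish, since
      \<open>0 powr (\<gamma> - 1) = 0\<close>.\<close>
    have "(LINT s:{0..t}|lebesgue. (t - s) powr (\<gamma> - 1) * f (s, u s)) = (\<integral>s. Gamma \<gamma> * (rl_kernel \<gamma> (t - s) * H s) \<partial>lborel)"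
      unfolding set_lebesgue_integral_def
    proof (rule borel_measurable_lebesgue_AE_eq(2))
      show "AE s in lborel. indicator {0..t} s *\<^sub>R ((t - s) powr (\<gamma> - 1) * f (s, u s)) = Gamma \<gamma> * (rl_kernel \<gamma> (t - s) * H s)"
        using H(2)
      proof eventually_elim
        case (elim s)
        consider "s < 0" | "0 \<le> s" "s < t" | "s = t" | "s > t" by linarith
        then show ?case
          using elim G t causal_neg[OF H(1), of s] by cases (auto simp: rl_kernel_def)
      qed
    qed measurable
    also have "\<dots> = Gamma \<gamma> * (\<integral>s. rl_kernel \<gamma> (t - s) * H s \<partial>lborel)" by simp
    also have "(\<integral>s. rl_kernel \<gamma> (t - s) * H s \<partial>lborel) = rl_int \<gamma> H t"
      using lborel_integral_real_affine[of "-1" "\<lambda>s. rl_kernel \<gamma> (t - s) * H s" t] by (simp add: rl_int_def)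
    finally show "cont_rep \<gamma> f u0 u t = u0 + rl_int \<gamma> H t" using G by (simp add: cont_rep_def)
  qed
qed

text \<open>Common input of the Gronwall estimate and of the positivity lemma: \<open>H\<close> is
  the difference of the two right-hand sides, which the Lipschitz condition bounds by the difference
  of the solutions.\<close>

lemma strong_solutions_difference:
  assumes \<gamma>: "0 < \<gamma>" "\<gamma> < 1" and f: "Linf_loc ({0..} \<times> UNIV) f" "loc_Lipschitz_ae f"
    and sol1: "strong_solution \<gamma> f T1 u10 u1" and sol2: "strong_solution \<gamma> f T2 u20 u2"
    and R: "0 < R" "ereal R < T1" "ereal R < T2"
    and M: "M > 0" "AE t in lborel. 0 \<le> t \<and> t \<le> R \<longrightarrow> \<bar>u1 t\<bar> \<le> M" "AE t in lborel. 0 \<le> t \<and> t \<le> R \<longrightarrow> \<bar>u2 t\<bar> \<le> M"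
    and L: "AE t in lborel. 0 \<le> t \<and> t \<le> R \<longrightarrow> (\<forall>v w. \<bar>v\<bar> \<le> M \<and> \<bar>w\<bar> \<le> M \<longrightarrow> \<bar>f (t, v) - f (t, w)\<bar> \<le> L * \<bar>v - w\<bar>)"
  obtains H where "causal H"
    "AE t in lborel. 0 \<le> t \<and> t \<le> R \<longrightarrow> u1 t - u2 t = u10 - u20 + rl_int \<gamma> H t"
    "AE t in lborel. 0 \<le> t \<and> t \<le> R \<longrightarrow> \<bar>H t\<bar> \<le> L * \<bar>u10 - u20 + rl_int \<gamma> H t\<bar>"
    "\<And>t. t \<le> R \<Longrightarrow> cont_rep \<gamma> f u10 u1 t - cont_rep \<gamma> f u20 u2 t = u10 - u20 + rl_int \<gamma> H t"
proof -
  obtain H1 where H1: "causal H1" "AE t in lborel. 0 \<le> t \<and> t \<le> R \<longrightarrow> H1 t = f (t, u1 t)"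
    "AE t in lborel. 0 \<le> t \<and> t \<le> R \<longrightarrow> u1 t = u10 + rl_int \<gamma> H1 t"
    "\<And>t. t \<le> R \<Longrightarrow> cont_rep \<gamma> f u10 u1 t = u10 + rl_int \<gamma> H1 t"
    by (rule strong_solution_Volterra[OF \<gamma> f sol1 R(1,2) M(1,2)]) blast
  obtain H2 where H2: "causal H2" "AE t in lborel. 0 \<le> t \<and> t \<le> R \<longrightarrow> H2 t = f (t, u2 t)"
    "AE t in lborel. 0 \<le> t \<and> t \<le> R \<longrightarrow> u2 t = u20 + rl_int \<gamma> H2 t"
    "\<And>t. t \<le> R \<Longrightarrow> cont_rep \<gamma> f u20 u2 t = u20 + rl_int \<gamma> H2 t"
    by (rule strong_solution_Volterra[OF \<gamma> f sol2 R(1,3) M(1,3)]) blast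
  let ?H = "\<lambda>t. H1 t - H2 t"
  have diff: "rl_int \<gamma> ?H t = rl_int \<gamma> H1 t - rl_int \<gamma> H2 t" for t
    by (intro rl_int_diff \<gamma> H1 H2)
  have eq: "AE t in lborel. 0 \<le> t \<and> t \<le> R \<longrightarrow> u1 t - u2 t = u10 - u20 + rl_int \<gamma> ?H t"
    using H1(3) H2(3) by eventually_elim (auto simp: diff)
  show ?thesis
  proof (rule that[of ?H])
    show "AE t in lborel. 0 \<le> t \<and> t \<le> R \<longrightarrow> \<bar>?H t\<bar> \<le> L * \<bar>u10 - u20 + rl_int \<gamma> ?H t\<bar>"
      using eq H1(2) H2(2) M(2,3) L
    proof eventually_elim
      case (elim t)
      show ?case
      proof
        assume t: "0 \<le> t \<and> t \<le> R"
        then have "\<bar>f (t, u1 t) - f (t, u2 t)\<bar> \<le> L * \<bar>u1 t - u2 t\<bar>" using elim by blast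
        then show "\<bar>?H t\<bar> \<le> L * \<bar>u10 - u20 + rl_int \<gamma> ?H t\<bar>" using elim t by simp
      qed
    qed
  qed (use H1 H2 eq diff in \<open>auto intro: causal_diff\<close>)
qed

text \<open>The rate \<open>\<mu> = (2 * L) powr (1 / \<gamma>)\<close> solves
  \<open>\<mu> powr \<gamma> = 2 * L\<close>, the borderline case of the Gronwall condition. The
  factor multiplying the initial difference depends only on \<open>L\<close>,
  \<open>\<gamma>\<close> and \<open>t\<close>, so it is uniform over solutions.\<close>

lemma strong_solutions_stability:
  assumes \<gamma>: "0 < \<gamma>" "\<gamma> < 1" and f: "Linf_loc ({0..} \<times> UNIV) f" "loc_Lipschitz_ae f"
    and sol1: "strong_solution \<gamma> f T1 u10 u1" and sol2: "strong_solution \<gamma> f T2 u20 u2"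
    and R: "0 < R" "ereal R < T1" "ereal R < T2"
    and M: "M > 0" "AE t in lborel. 0 \<le> t \<and> t \<le> R \<longrightarrow> \<bar>u1 t\<bar> \<le> M" "AE t in lborel. 0 \<le> t \<and> t \<le> R \<longrightarrow> \<bar>u2 t\<bar> \<le> M"
    and L: "AE t in lborel. 0 \<le> t \<and> t \<le> R \<longrightarrow> (\<forall>v w. \<bar>v\<bar> \<le> M \<and> \<bar>w\<bar> \<le> M \<longrightarrow> \<bar>f (t, v) - f (t, w)\<bar> \<le> L * \<bar>v - w\<bar>)"
    and L0: "L > 0"
  shows "AE t in lborel. 0 \<le> t \<and> t \<le> R \<longrightarrow> \<bar>u1 t - u2 t\<bar> \<le> 2 * \<bar>u10 - u20\<bar> * exp ((2 * L) powr (1 / \<gamma>) * t)"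
proof -
  define c where "c = u10 - u20"
  obtain H where H: "causal H"
    "AE t in lborel. 0 \<le> t \<and> t \<le> R \<longrightarrow> u1 t - u2 t = c + rl_int \<gamma> H t"
    "AE t in lborel. 0 \<le> t \<and> t \<le> R \<longrightarrow> \<bar>H t\<bar> \<le> L * \<bar>c + rl_int \<gamma> H t\<bar>"
    unfolding c_def by (rule strong_solutions_difference[OF \<gamma> f sol1 sol2 R M L]) blast
  have V: "causal (rl_int \<gamma> H)" by (intro causal_rl_int \<gamma> H)
  note [measurable] = causal_measurable[OF V]
  \<comment> \<open>The cutoff replaces the value \<open>c\<close> at negative times by the
    \<open>0\<close> that \<open>causal\<close> requires.\<close>
  define w where "w t = (if 0 \<le> t then c + rl_int \<gamma> H t else 0)" for t
  have w: "causal w"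
    unfolding causal_def
  proof (intro conjI allI impI)
    show "w \<in> borel_measurable borel" unfolding w_def by measurable
    show "w t = 0" if "t < 0" for t using that by (simp add: w_def)
    fix R
    obtain B where "\<forall>t\<le>R. \<bar>rl_int \<gamma> H t\<bar> \<le> B" using V unfolding causal_def by meson
    then have "\<bar>w t\<bar> \<le> \<bar>c\<bar> + B" if "t \<le> R" for t
      using that abs_triangle_ineq[of c "rl_int \<gamma> H t"] abs_ge_zero[of "rl_int \<gamma> H t"]
      by (auto simp: w_def)
    then show "\<exists>B. \<forall>t\<le>R. \<bar>w t\<bar> \<le> B" by blast
  qed
  have Lw: "causal (\<lambda>s. L * \<bar>w s\<bar>)"
    unfolding causal_def
  proof (intro conjI allI impI)
    note [measurable] = causal_measurable[OF w]
    show "(\<lambda>s. L * \<bar>w s\<bar>) \<in> borel_measurable borel" by measurable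
    show "L * \<bar>w t\<bar> = 0" if "t < 0" for t using causal_neg[OF w that] by simp
    fix R
    obtain B where "\<forall>t\<le>R. \<bar>w t\<bar> \<le> B" using w unfolding causal_def by meson
    then have "\<forall>t\<le>R. \<bar>L * \<bar>w t\<bar>\<bar> \<le> L * B" using L0 by (simp add: abs_mult)
    then show "\<exists>B. \<forall>t\<le>R. \<bar>L * \<bar>w t\<bar>\<bar> \<le> B" by blast
  qed
  have "\<bar>w t\<bar> \<le> \<bar>c\<bar> + L * rl_int \<gamma> (\<lambda>s. \<bar>w s\<bar>) t" if "0 \<le> t \<and> t \<le> R" for t
  proof -
    have "\<bar>rl_int \<gamma> H t\<bar> \<le> rl_int \<gamma> (\<lambda>s. L * \<bar>w s\<bar>) t"
    proof (rule rl_int_mono_bound[OF \<gamma>(1) H(1) Lw])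
      show "AE s in lborel. s \<le> t \<longrightarrow> \<bar>H s\<bar> \<le> L * \<bar>w s\<bar>"
        using H(3) by eventually_elim (use that causal_neg[OF H(1)] L0 in \<open>auto simp: w_def\<close>)
    qed
    also have "\<dots> = L * rl_int \<gamma> (\<lambda>s. \<bar>w s\<bar>) t"
      by (simp add: rl_int_def mult.left_commute[of _ L])
    finally show ?thesis using that by (simp add: w_def)
  qed
  then have "AE t in lborel. 0 \<le> t \<and> t \<le> R \<longrightarrow> \<bar>w t\<bar> \<le> 2 * \<bar>c\<bar> * exp ((2 * L) powr (1 / \<gamma>) * t)"
    using L0 \<gamma> by (intro fractional_Gronwall[where L = L and \<gamma> = \<gamma>] w) (auto simp: powr_powr)
  then show ?thesis
    using H(2) by eventually_elim (auto simp: w_def c_def)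
qed

section \<open>From compact subintervals to the full interval\<close>

text \<open>Rational endpoints \<open>R\<close> suffice, so only countably many null sets are
  united.\<close>

lemma AE_Ico:
  assumes "\<And>R. \<lbrakk>0 < R; ereal R < T\<rbrakk> \<Longrightarrow> AE t in lborel. 0 \<le> t \<and> t \<le> R \<longrightarrow> P t"
  shows "AE t in lborel. t \<in> Ico T \<longrightarrow> P t"
proof -
  have "AE t in lborel. \<forall>q::rat. 0 < real_of_rat q \<and> ereal (real_of_rat q) < T \<longrightarrow> 0 \<le> t \<and> t \<le> real_of_rat q \<longrightarrow> P t"
    unfolding AE_all_countable
  proof
    fix q :: rat
    show "AE t in lborel. 0 < real_of_rat q \<and> ereal (real_of_rat q) < T \<longrightarrow> 0 \<le> t \<and> t \<le> real_of_rat q \<longrightarrow> P t"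
    proof (cases "0 < real_of_rat q \<and> ereal (real_of_rat q) < T")
      case True
      with assms[of "real_of_rat q"] show ?thesis by (auto elim!: eventually_mono)
    qed auto
  qed
  then show ?thesis
  proof eventually_elim
    case (elim t)
    show ?case
    proof
      assume t: "t \<in> Ico T"
      then obtain z where z: "ereal t < ereal z" "ereal z < T" using ereal_dense2[of "ereal t" T] by (auto simp: Ico_def)
      then obtain q where q: "t < real_of_rat q" "real_of_rat q < z" using of_rat_dense[of t z] by auto
      then have "ereal (real_of_rat q) < T" using z(2) by (meson ereal_less_eq(3) le_less_trans less_imp_le)
      moreover have "0 \<le> t" "0 < real_of_rat q" using q(1) t by (auto simp: Ico_def simp del: zero_less_of_rat_iff)
      ultimately show "P t" using elim q(1) by (meson less_imp_le)
    qed
  qed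
qed

lemma Linf_loc_Ico_bound:
  assumes "Linf_loc (Ico T) u" "ereal R < T"
  obtains M where "M > 0" "AE t in lborel. 0 \<le> t \<and> t \<le> R \<longrightarrow> \<bar>u t\<bar> \<le> M"
proof -
  have "{0..R} \<subseteq> Ico T"
    using assms(2) by (auto simp: Ico_def) (meson ereal_less_eq(3) le_less_trans)
  then have "Linf_norm {0..R} u < \<infinity>" using assms(1) unfolding Linf_loc_def by blast
  then obtain M where "M > 0" "AE t in lborel. t \<in> {0..R} \<longrightarrow> \<bar>u t\<bar> \<le> M"
    using Linf_norm_finite_bound[of "{0..R}" u] by auto
  then show ?thesis using that by simp
qed

text \<open>Integrability on \<open>{0..T - 1 / real (Suc n)}\<close> gives measurability on
  \<open>{0..<T}\<close> in the limit, and a single point can be added with any value. It serves the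
  essential supremum over the closed interval, whose estimate requires measurability.\<close>

lemma L1_loc_measurable:
  assumes "L1_loc (ereal T) u"
  shows "u \<in> borel_measurable (lebesgue_on {0..T})"
proof -
  have "(\<lambda>t. indicator {0..<T} t *\<^sub>R u t) \<in> borel_measurable lebesgue"
  proof (rule borel_measurable_LIMSEQ_real)
    show "(\<lambda>t. indicator {0..T - 1 / real (Suc n)} t *\<^sub>R u t) \<in> borel_measurable lebesgue" for n
    proof -
      have "set_integrable lebesgue {0..T - 1 / real (Suc n)} u"
        using assms by (auto simp: L1_loc_def)
      then show ?thesis unfolding set_integrable_def by (rule borel_measurable_integrable)
    qed
    fix t
    show "(\<lambda>n. indicator {0..T - 1 / real (Suc n)} t *\<^sub>R u t) \<longlonglongrightarrow> indicator {0..<T} t *\<^sub>R u t"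
    proof (cases "t < T")
      case True
      have "(\<lambda>n. 1 / real (Suc n)) \<longlonglongrightarrow> 0" by (rule LIMSEQ_Suc[OF lim_const_over_n])
      then have "\<forall>\<^sub>F n in sequentially. 1 / real (Suc n) < T - t" using True by (intro order_tendstoD(2)) auto
      then have "\<forall>\<^sub>F n in sequentially. indicator {0..T - 1 / real (Suc n)} t *\<^sub>R u t = indicator {0..<T} t *\<^sub>R u t"
        by eventually_elim (use True in \<open>auto simp: indicator_def\<close>)
      then show ?thesis by (rule tendsto_eventually)
    next
      case False
      then have "t \<notin> {0..T - 1 / real (Suc n)}" for n
      proof -
        have "1 / real (Suc n) > 0" by simp
        then show ?thesis using False by (simp only: atLeastAtMost_iff) linarith
      qed
      then show ?thesis using False by simp
    qed
  qed
  then have "(\<lambda>t. indicator {0..<T} t *\<^sub>R u t + u T * indicator {T} t) \<in> borel_measurable lebesgue"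
    by (intro borel_measurable_add borel_measurable_times borel_measurable_const borel_measurable_indicator) auto
  then have "(\<lambda>t. indicator {0..<T} t *\<^sub>R u t + u T * indicator {T} t) \<in> borel_measurable (lebesgue_on {0..T})"
    by (rule measurable_restrict_space1)
  then show ?thesis
    by (subst measurable_cong[where g = "\<lambda>t. indicator {0..<T} t *\<^sub>R u t + u T * indicator {T} t"])
       (auto simp: indicator_def)
qed

section \<open>Uniqueness, strict ordering and stability\<close>

theorem theorem4p1:
  fixes \<gamma> :: real and f :: "real \<times> real \<Rightarrow> real"
  assumes "0 < \<gamma>" "\<gamma> < 1"
    and "Linf_loc ({0..} \<times> UNIV) f"
    and "loc_Lipschitz_ae f"
  shows "(\<forall>(u0::real) (Tb::ereal) u v.
            strong_solution \<gamma> f Tb u0 u \<and> Linf_loc (Ico Tb) u \<and>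
            strong_solution \<gamma> f Tb u0 v \<and> Linf_loc (Ico Tb) v \<longrightarrow>
            (AE t in lebesgue. t \<in> Ico Tb \<longrightarrow> u t = v t)) \<and>
         (\<forall>(u10::real) (u20::real) (Tb1::ereal) (Tb2::ereal) u1 u2.
            strong_solution \<gamma> f Tb1 u10 u1 \<and> Linf_loc (Ico Tb1) u1 \<and>
            strong_solution \<gamma> f Tb2 u20 u2 \<and> Linf_loc (Ico Tb2) u2 \<and>
            u10 < u20 \<longrightarrow>
            (\<forall>t\<in>Ico (min Tb1 Tb2). cont_rep \<gamma> f u10 u1 t < cont_rep \<gamma> f u20 u2 t)) \<and>
         (\<forall>(T::real) (M::real). 0 < T \<and> 0 < M \<longrightarrow>
            (\<exists>C>0. \<forall>(u10::real) (u20::real) u1 u2.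
               strong_solution \<gamma> f (ereal T) u10 u1 \<and> Linf_norm {0..T} u1 \<le> ereal M \<and>
               strong_solution \<gamma> f (ereal T) u20 u2 \<and> Linf_norm {0..T} u2 \<le> ereal M \<longrightarrow>
               Linf_norm {0..T} (\<lambda>t. u1 t - u2 t) \<le> ereal (C * \<bar>u10 - u20\<bar>)))"
proof (intro conjI allI impI ballI; (elim conjE)?)
  fix u0 Tb u v
  assume u: "strong_solution \<gamma> f Tb u0 u" "Linf_loc (Ico Tb) u"
    and v: "strong_solution \<gamma> f Tb u0 v" "Linf_loc (Ico Tb) v"
  have "AE t in lborel. t \<in> Ico Tb \<longrightarrow> u t = v t"
  proof (rule AE_Ico)
    fix R assume R: "0 < R" "ereal R < Tb"
    obtain M1 where M1: "M1 > 0" "AE t in lborel. 0 \<le> t \<and> t \<le> R \<longrightarrow> \<bar>u t\<bar> \<le> M1"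
      using Linf_loc_Ico_bound[OF u(2) R(2)] .
    obtain M2 where M2: "M2 > 0" "AE t in lborel. 0 \<le> t \<and> t \<le> R \<longrightarrow> \<bar>v t\<bar> \<le> M2"
      using Linf_loc_Ico_bound[OF v(2) R(2)] .
    \<comment> \<open>A common bound puts both solutions into one rectangle, where one Lipschitz
      constant serves.\<close>
    define M where "M = max M1 M2"
    have M: "M > 0" using M1(1) by (simp add: M_def)
    have u_le: "AE t in lborel. 0 \<le> t \<and> t \<le> R \<longrightarrow> \<bar>u t\<bar> \<le> M"
      using M1(2) by eventually_elim (auto simp: M_def)
    have v_le: "AE t in lborel. 0 \<le> t \<and> t \<le> R \<longrightarrow> \<bar>v t\<bar> \<le> M"
      using M2(2) by eventually_elim (auto simp: M_def)
    obtain L where L: "L > 0" "AE t in lborel. 0 \<le> t \<and> t \<le> R \<longrightarrow> (\<forall>v w. \<bar>v\<bar> \<le> M \<and> \<bar>w\<bar> \<le> M \<longrightarrow> \<bar>f (t, v) - f (t, w)\<bar> \<le> L * \<bar>v - w\<bar>)"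
      using Lipschitz_on_rectangle[OF assms(4)] .
    show "AE t in lborel. 0 \<le> t \<and> t \<le> R \<longrightarrow> u t = v t"
      using strong_solutions_stability[OF assms u(1) v(1) R R(2) M u_le v_le L(2,1)] by simp
  qed
  then show "AE t in lebesgue. t \<in> Ico Tb \<longrightarrow> u t = v t" by (simp add: AE_completion_iff)
next
  fix u10 u20 :: real and Tb1 Tb2 u1 u2 t
  assume u1: "strong_solution \<gamma> f Tb1 u10 u1" "Linf_loc (Ico Tb1) u1"
    and u2: "strong_solution \<gamma> f Tb2 u20 u2" "Linf_loc (Ico Tb2) u2"
    and less: "u10 < u20" and t: "t \<in> Ico (min Tb1 Tb2)"
  \<comment> \<open>The local bounds are available on closed subintervals only, hence a time
    strictly between \<open>t\<close> and both right endpoints.\<close>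
  obtain R where "ereal t < ereal R" "ereal R < min Tb1 Tb2"
    using t ereal_dense2[of "ereal t" "min Tb1 Tb2"] by (auto simp: Ico_def)
  then have R: "0 < R" "ereal R < Tb1" "ereal R < Tb2" "t < R" using t by (auto simp: Ico_def)
  obtain M1 where M1: "M1 > 0" "AE t in lborel. 0 \<le> t \<and> t \<le> R \<longrightarrow> \<bar>u1 t\<bar> \<le> M1"
    using Linf_loc_Ico_bound[OF u1(2) R(2)] .
  obtain M2 where M2: "M2 > 0" "AE t in lborel. 0 \<le> t \<and> t \<le> R \<longrightarrow> \<bar>u2 t\<bar> \<le> M2"
    using Linf_loc_Ico_bound[OF u2(2) R(3)] .
  define M where "M = max M1 M2"
  have M: "M > 0" using M1(1) by (simp add: M_def)
  have u1_le: "AE t in lborel. 0 \<le> t \<and> t \<le> R \<longrightarrow> \<bar>u1 t\<bar> \<le> M"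
    using M1(2) by eventually_elim (auto simp: M_def)
  have u2_le: "AE t in lborel. 0 \<le> t \<and> t \<le> R \<longrightarrow> \<bar>u2 t\<bar> \<le> M"
    using M2(2) by eventually_elim (auto simp: M_def)
  obtain L where L: "L > 0" "AE t in lborel. 0 \<le> t \<and> t \<le> R \<longrightarrow> (\<forall>v w. \<bar>v\<bar> \<le> M \<and> \<bar>w\<bar> \<le> M \<longrightarrow> \<bar>f (t, v) - f (t, w)\<bar> \<le> L * \<bar>v - w\<bar>)"
    using Lipschitz_on_rectangle[OF assms(4)] .
  \<comment> \<open>The solution with the larger initial value comes first, so that the difference
    starts at \<open>u20 - u10 > 0\<close>.\<close>
  obtain H where H: "causal H"
    "AE t in lborel. 0 \<le> t \<and> t \<le> R \<longrightarrow> \<bar>H t\<bar> \<le> L * \<bar>u20 - u10 + rl_int \<gamma> H t\<bar>"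
    "\<And>t. t \<le> R \<Longrightarrow> cont_rep \<gamma> f u20 u2 t - cont_rep \<gamma> f u10 u1 t = u20 - u10 + rl_int \<gamma> H t"
    by (rule strong_solutions_difference[OF assms u2(1) u1(1) R(1,3,2) M u2_le u1_le L(2)]) blast
  have "u20 - u10 + rl_int \<gamma> H t > 0"
    using less L(1) t R(4)
    by (intro Volterra_positivity[OF assms(1,2) _ _ H(1) refl H(2)]) (auto simp: Ico_def)
  then show "cont_rep \<gamma> f u10 u1 t < cont_rep \<gamma> f u20 u2 t" using H(3)[of t] R(4) by simp
next
  fix T M :: real assume T: "0 < T" and M: "0 < M"
  \<comment> \<open>\<open>L\<close> is fixed from \<open>M\<close> and \<open>T\<close> before any
    solution is chosen, which makes \<open>C\<close> uniform.\<close>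
  obtain L where L: "L > 0" "AE t in lborel. 0 \<le> t \<and> t \<le> T \<longrightarrow> (\<forall>v w. \<bar>v\<bar> \<le> M \<and> \<bar>w\<bar> \<le> M \<longrightarrow> \<bar>f (t, v) - f (t, w)\<bar> \<le> L * \<bar>v - w\<bar>)"
    using Lipschitz_on_rectangle[OF assms(4)] .
  \<comment> \<open>The exponential of the stability estimate, taken at the largest time
    \<open>T\<close>.\<close>
  define C where "C = 2 * exp ((2 * L) powr (1 / \<gamma>) * T)"
  have "Linf_norm {0..T} (\<lambda>t. u1 t - u2 t) \<le> ereal (C * \<bar>u10 - u20\<bar>)"
    if u1: "strong_solution \<gamma> f (ereal T) u10 u1" "Linf_norm {0..T} u1 \<le> ereal M"
      and u2: "strong_solution \<gamma> f (ereal T) u20 u2" "Linf_norm {0..T} u2 \<le> ereal M" for u10 u20 u1 u2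
  proof -
    have "AE t in lborel. t \<in> Ico (ereal T) \<longrightarrow> \<bar>u1 t - u2 t\<bar> \<le> C * \<bar>u10 - u20\<bar>"
    proof (rule AE_Ico)
      fix R assume R: "0 < R" "ereal R < ereal T"
      have "AE t in lborel. 0 \<le> t \<and> t \<le> R \<longrightarrow> \<bar>u1 t - u2 t\<bar> \<le> 2 * \<bar>u10 - u20\<bar> * exp ((2 * L) powr (1 / \<gamma>) * t)"
      proof (rule strong_solutions_stability[OF assms u1(1) u2(1) R R(2) M])
        show "AE t in lborel. 0 \<le> t \<and> t \<le> R \<longrightarrow> \<bar>u1 t\<bar> \<le> M"
          using AE_le_Linf_norm[OF _ u1(2), simplified] by eventually_elim (use R in auto)
        show "AE t in lborel. 0 \<le> t \<and> t \<le> R \<longrightarrow> \<bar>u2 t\<bar> \<le> M"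
          using AE_le_Linf_norm[OF _ u2(2), simplified] by eventually_elim (use R in auto)
        show "AE t in lborel. 0 \<le> t \<and> t \<le> R \<longrightarrow> (\<forall>v w. \<bar>v\<bar> \<le> M \<and> \<bar>w\<bar> \<le> M \<longrightarrow> \<bar>f (t, v) - f (t, w)\<bar> \<le> L * \<bar>v - w\<bar>)"
          using L(2) by eventually_elim (use R in auto)
      qed (rule L(1))
      then show "AE t in lborel. 0 \<le> t \<and> t \<le> R \<longrightarrow> \<bar>u1 t - u2 t\<bar> \<le> C * \<bar>u10 - u20\<bar>"
      proof eventually_elim
        case (elim t)
        show ?case
        proof
          assume t: "0 \<le> t \<and> t \<le> R"
          then have "\<bar>u1 t - u2 t\<bar> \<le> 2 * \<bar>u10 - u20\<bar> * exp ((2 * L) powr (1 / \<gamma>) * t)" using elim by blast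
          also have "\<dots> \<le> 2 * \<bar>u10 - u20\<bar> * exp ((2 * L) powr (1 / \<gamma>) * T)"
            using t R by (intro mult_left_mono) (auto intro: mult_left_mono)
          finally show "\<bar>u1 t - u2 t\<bar> \<le> C * \<bar>u10 - u20\<bar>" by (simp add: C_def mult_ac)
        qed
      qed
    qed
    \<comment> \<open>The endpoint \<open>T\<close>, absent from \<open>Ico (ereal T)\<close>, is a
      null set.\<close>
    then have "AE t in lborel. t \<in> {0..T} \<longrightarrow> \<bar>u1 t - u2 t\<bar> \<le> C * \<bar>u10 - u20\<bar>"
      using AE_lborel_singleton[of T] by eventually_elim (auto simp: Ico_def)
    then have "AE t in lebesgue_on {0..T}. \<bar>u1 t - u2 t\<bar> \<le> C * \<bar>u10 - u20\<bar>"
      by (simp add: AE_restrict_space_iff AE_completion_iff)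
    moreover have "u1 \<in> borel_measurable (lebesgue_on {0..T})" "u2 \<in> borel_measurable (lebesgue_on {0..T})"
      using u1(1) u2(1) by (auto simp: strong_solution_def intro!: L1_loc_measurable)
    ultimately show ?thesis
      unfolding Linf_norm_def by (intro esssup_I) auto
  qed
  moreover have "C > 0" by (simp add: C_def)
  ultimately show "\<exists>C>0. \<forall>u10 u20 u1 u2.
               strong_solution \<gamma> f (ereal T) u10 u1 \<and> Linf_norm {0..T} u1 \<le> ereal M \<and>
               strong_solution \<gamma> f (ereal T) u20 u2 \<and> Linf_norm {0..T} u2 \<le> ereal M \<longrightarrow>
               Linf_norm {0..T} (\<lambda>t. u1 t - u2 t) \<le> ereal (C * \<bar>u10 - u20\<bar>)"
    by blast
qed

end
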